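(* For every core-compact space $X$, $\mathbf V X$ and $\mathbf V_{\leq 1} X$ are locally compact and sober. If $X$ is also compact, then $\mathbf V_1 X$ is locally compact and sober.
   Context: $\mathcal O X$ is the lattice of open subsets of $X$, ordered by inclusion. $X$ is core-compact iff $\mathcal O X$ is a continuous dcpo, i.e., every open set $U$ is the union of the open sets $V \ll U$, where $V \ll U$ means that every directed family of open sets whose union contains $U$ has a member containing $V$. Compactness is the open cover property, with no separation axiom. A space is locally compact iff every point has a base of compact neighborhoods, and sober iff it is $T_0$ and every irreducible closed subset is the closure of a point. A continuous valuation on $X$ is a Scott-continuous map (monotonic and preserving directed suprema) $\nu \colon \mathcal O X \to \overline{\mathbb R}_+ = \mathbb R_+ \cup \{\infty\}$ with $\nu(\emptyset)=0$ and $\nu(U)+\nu(V)=\nu(U\cup V)+\nu(U\cap V)$ for all open $U,V$. $\mathbf V X$ is the space of all continuous valuations on $X$ with the weak topology, generated by the sets $\{\nu \mid \nu(U)>r\}$, $U \in \mathcal O X$, $r \in \mathbb R_+$. $\mathbf V_{\leq 1} X$ and $\mathbf V_1 X$ are the subspaces of those $\nu$ with $\nu(X)\leq 1$, resp. $\nu(X)=1$. *)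

theory Defs
  imports "HOL-Analysis.Analysis"
begin

definition directed_family :: "'a set set \<Rightarrow> bool" where
  "directed_family F \<longleftrightarrow> F \<noteq> {} \<and> (\<forall>U\<in>F. \<forall>V\<in>F. \<exists>W\<in>F. U \<subseteq> W \<and> V \<subseteq> W)"

definition way_below_in :: "'a topology \<Rightarrow> 'a set \<Rightarrow> 'a set \<Rightarrow> bool" where
  "way_below_in X V U \<longleftrightarrow>
     (\<forall>F. (\<forall>W\<in>F. openin X W) \<and> directed_family F \<and> U \<subseteq> \<Union>F \<longrightarrow> (\<exists>W\<in>F. V \<subseteq> W))"

definition core_compact_space :: "'a topology \<Rightarrow> bool" where
  "core_compact_space X \<longleftrightarrow>
     (\<forall>U. openin X U \<longrightarrow> U = \<Union>{V. openin X V \<and> way_below_in X V U})"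

text \<open>Local compactness in the strong sense (a base of compact neighbourhoods at each point).
  In the absence of separation this is stronger than \<^const>\<open>locally_compact_space\<close>, which only asks
  for one compact neighbourhood of each point.\<close>

definition strongly_locally_compact_space :: "'a topology \<Rightarrow> bool" where
  "strongly_locally_compact_space X \<longleftrightarrow> neighbourhood_base_of (compactin X) X"

definition irreducible_closedin :: "'a topology \<Rightarrow> 'a set \<Rightarrow> bool" where
  "irreducible_closedin X C \<longleftrightarrow> closedin X C \<and> C \<noteq> {} \<and>
     (\<forall>A B. closedin X A \<and> closedin X B \<and> C \<subseteq> A \<union> B \<longrightarrow> C \<subseteq> A \<or> C \<subseteq> B)"

definition sober_space :: "'a topology \<Rightarrow> bool" where
  "sober_space X \<longleftrightarrow> t0_space X \<and>
     (\<forall>C. irreducible_closedin X C \<longrightarrow> (\<exists>x\<in>topspace X. C = X closure_of {x}))"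

text \<open>A valuation is defined on the open sets only; as a HOL function on all sets it is
  required to be \<^const>\<open>undefined\<close> elsewhere, so that equality of valuations is equality on open sets.\<close>

definition continuous_valuations :: "'a topology \<Rightarrow> ('a set \<Rightarrow> ennreal) set" where
  "continuous_valuations X = {\<nu> \<in> extensional {U. openin X U}.
     \<nu> {} = 0 \<and>
     (\<forall>U V. openin X U \<and> openin X V \<longrightarrow> \<nu> U + \<nu> V = \<nu> (U \<union> V) + \<nu> (U \<inter> V)) \<and>
     (\<forall>U V. openin X U \<and> openin X V \<and> U \<subseteq> V \<longrightarrow> \<nu> U \<le> \<nu> V) \<and>
     (\<forall>F. (\<forall>W\<in>F. openin X W) \<and> directed_family F \<longrightarrow> \<nu> (\<Union>F) = (SUP W\<in>F. \<nu> W))}"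

text \<open>The whole space is added to the generators because the zero valuation belongs to none of
  the subbasic sets, while the carrier of \<^term>\<open>topology_generated_by\<close> is the union of its
  generators.\<close>

definition valuation_space :: "'a topology \<Rightarrow> ('a set \<Rightarrow> ennreal) topology" where
  "valuation_space X = topology_generated_by
     (insert (continuous_valuations X)
       {{\<nu> \<in> continuous_valuations X. \<nu> U > ennreal r} | U r. openin X U \<and> r \<ge> 0})"

definition subprobability_valuation_space :: "'a topology \<Rightarrow> ('a set \<Rightarrow> ennreal) topology" where
  "subprobability_valuation_space X = subtopology (valuation_space X) {\<nu>. \<nu> (topspace X) \<le> 1}"

definition probability_valuation_space :: "'a topology \<Rightarrow> ('a set \<Rightarrow> ennreal) topology" where
  "probability_valuation_space X = subtopology (valuation_space X) {\<nu>. \<nu> (topspace X) = 1}"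

lemma topspace_valuation_space: "topspace (valuation_space X) = continuous_valuations X"
  unfolding valuation_space_def topology_generated_by_topspace by auto

end

theory Submission
  imports Defs
begin

text \<open>
  Sobriety is the easier half: the pointwise supremum of an irreducible closed set of valuations is a continuous valuation, and it is the generic point of that set
  (\<open>sober_valuation_subspace\<close>).

  For local compactness, the compact neighbourhoods are the sets of all continuous valuations above a function
  \<open>c\<close> that sends \<open>U\<close> to the sum of the weights \<open>a j\<close> with \<open>U \<in> F j\<close>, for
  finitely many Scott-open filters \<open>F j\<close> of open sets. Intuitively such a valuation contains, for each
  \<open>j\<close>, mass \<open>a j\<close> inside the compact set encoded by \<open>F j\<close>. Every neighbourhood of \<open>\<nu>\<close>
  contains a neighbourhood of this form (\<open>valuations_above_neighbourhood\<close>): the mass of \<open>\<nu>\<close> is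
  distributed over a finite family of open sets closed under intersection, and core-compactness makes it
  possible to shrink these sets slightly and to interpolate filters.

  These sets are compact (\<open>compactin_valuations_above_filter_capacity\<close>), although intersections of compact
  saturated subsets of \<open>X\<close> need not be compact and limits of continuous valuations, taken setwise, need not have a largest
  continuous valuation below them. The remedy is to compactify by monotone submodular functions: those above
  \<open>c\<close> and bounded by the total weight form a compact space by Tychonoff's theorem, and the sandwich theorem
  \<open>filter_capacity_sandwich\<close> finds a continuous valuation between \<open>c\<close> and any submodular \<open>q \<ge> c\<close>.
  A weakly open set that contains this valuation also contains every valuation whose truncation is close to
  \<open>q\<close>, so a finite subcover of the space of functions yields one of the set of valuations.

  The sandwich theorem is a Hahn-Banach argument in lattice form. For a single filter, a minimal submodular function
  above the indicator of the filter turns out to be modular and Scott-continuous, because otherwise an explicit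
  construction would decrease it. For several filters the masses are split off one after the other, as in a
  proof of the marriage theorem by tight sets.

  Subprobability valuations form a closed subspace. For probability valuations on a compact space the missing
  mass is added to \<open>c\<close> through the Scott-open filter that consists of the whole space.
\<close>

section \<open>Way-below approximation and Scott-open filters\<close>

definition scott_open_filter :: "'a topology \<Rightarrow> 'a set set \<Rightarrow> bool" where
  "scott_open_filter X F \<longleftrightarrow> (\<forall>U\<in>F. openin X U) \<and> topspace X \<in> F \<and>
     (\<forall>U V. U \<in> F \<and> openin X V \<and> U \<subseteq> V \<longrightarrow> V \<in> F) \<and>
     (\<forall>U\<in>F. \<forall>V\<in>F. U \<inter> V \<in> F) \<and>
     (\<forall>D. (\<forall>W\<in>D. openin X W) \<and> directed_family D \<and> \<Union>D \<in> F \<longrightarrow> (\<exists>W\<in>D. W \<in> F))"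

lemma scott_open_filterD:
  assumes "scott_open_filter X F"
  shows "U \<in> F \<Longrightarrow> openin X U" and "topspace X \<in> F"
    and "U \<in> F \<Longrightarrow> openin X V \<Longrightarrow> U \<subseteq> V \<Longrightarrow> V \<in> F"
    and "U \<in> F \<Longrightarrow> V \<in> F \<Longrightarrow> U \<inter> V \<in> F"
    and "(\<And>W. W \<in> D \<Longrightarrow> openin X W) \<Longrightarrow> directed_family D \<Longrightarrow> \<Union>D \<in> F \<Longrightarrow> \<exists>W\<in>D. W \<in> F"
proof -
  note F = assms[unfolded scott_open_filter_def]
  note F2 = F[THEN conjunct2, THEN conjunct2]
  show "U \<in> F \<Longrightarrow> openin X U" "topspace X \<in> F" using F[THEN conjunct1] F[THEN conjunct2, THEN conjunct1] by auto
  show "U \<in> F \<Longrightarrow> openin X V \<Longrightarrow> U \<subseteq> V \<Longrightarrow> V \<in> F" using F2[THEN conjunct1] by blast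
  show "U \<in> F \<Longrightarrow> V \<in> F \<Longrightarrow> U \<inter> V \<in> F" using F2[THEN conjunct2, THEN conjunct1] by blast
  show "(\<And>W. W \<in> D \<Longrightarrow> openin X W) \<Longrightarrow> directed_family D \<Longrightarrow> \<Union>D \<in> F \<Longrightarrow> \<exists>W\<in>D. W \<in> F"
    using F2[THEN conjunct2, THEN conjunct2, rule_format, of D] by blast
qed

lemma way_below_mono:
  "way_below_in X V U \<Longrightarrow> V' \<subseteq> V \<Longrightarrow> U \<subseteq> U' \<Longrightarrow> way_below_in X V' U'"
  unfolding way_below_in_def by (meson order_trans)

lemma way_below_imp_subset:
  assumes "way_below_in X V U" "openin X U" shows "V \<subseteq> U"
  using assms(1)[unfolded way_below_in_def directed_family_def, rule_format, of "{U}"] assms(2) by simp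

lemma way_below_empty: "way_below_in X {} U"
  unfolding way_below_in_def directed_family_def by (meson empty_subsetI ex_in_conv)

lemma way_below_Un:
  assumes "way_below_in X V U" "way_below_in X V' U'"
  shows "way_below_in X (V \<union> V') (U \<union> U')"
  unfolding way_below_in_def
proof (intro allI impI)
  fix F assume F: "(\<forall>W\<in>F. openin X W) \<and> directed_family F \<and> U \<union> U' \<subseteq> \<Union>F"
  obtain A where "A \<in> F" "V \<subseteq> A" using F assms(1) unfolding way_below_in_def by (meson Un_subset_iff)
  moreover obtain B where "B \<in> F" "V' \<subseteq> B" using F assms(2) unfolding way_below_in_def by (meson Un_subset_iff)
  ultimately show "\<exists>W\<in>F. V \<union> V' \<subseteq> W"
    using F unfolding directed_family_def by (meson Un_least order_trans)
qed

lemma way_below_UN: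
  assumes "finite I" "\<And>i. i \<in> I \<Longrightarrow> way_below_in X (V i) U"
  shows "way_below_in X (\<Union>i\<in>I. V i) U"
  using assms
proof (induction I)
  case empty then show ?case by (simp add: way_below_empty)
next
  case (insert i I)
  then show ?case using way_below_Un[of X "V i" U "\<Union>i\<in>I. V i" U] by simp
qed

lemma directed_way_below:
  assumes "core_compact_space X" "openin X U"
  shows "directed_family {V. openin X V \<and> way_below_in X V U}"
    and "\<Union>{V. openin X V \<and> way_below_in X V U} = U"
proof -
  show "directed_family {V. openin X V \<and> way_below_in X V U}"
    unfolding directed_family_def
  proof (intro conjI ballI)
    show "{V. openin X V \<and> way_below_in X V U} \<noteq> {}"
      using way_below_empty[of X U] openin_empty[of X] by blast
    fix A B assume "A \<in> {V. openin X V \<and> way_below_in X V U}" "B \<in> {V. openin X V \<and> way_below_in X V U}"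
    then show "\<exists>W\<in>{V. openin X V \<and> way_below_in X V U}. A \<subseteq> W \<and> B \<subseteq> W"
      using way_below_Un[of X A U B U] by (intro bexI[of _ "A \<union> B"]) auto
  qed
  show "\<Union>{V. openin X V \<and> way_below_in X V U} = U"
    using assms unfolding core_compact_space_def by metis
qed

text \<open>
  The sets way below some set way below \<open>U\<close> already form a directed cover of \<open>U\<close>, so \<open>V\<close>
  lies inside one of them.
\<close>

lemma way_below_interpolate:
  assumes cc: "core_compact_space X" and U: "openin X U" and VU: "way_below_in X V U"
  shows "\<exists>W. openin X W \<and> way_below_in X V W \<and> way_below_in X W U"
proof -
  define F where "F = {A. openin X A \<and> (\<exists>W. openin X W \<and> way_below_in X A W \<and> way_below_in X W U)}"
  have "directed_family F"
    unfolding directed_family_def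
  proof (intro conjI ballI)
    show "F \<noteq> {}" unfolding F_def using way_below_empty[of X] openin_empty[of X] by blast
    fix A B assume "A \<in> F" "B \<in> F"
    then obtain A' B' where *: "openin X A" "openin X A'" "way_below_in X A A'" "way_below_in X A' U"
       "openin X B" "openin X B'" "way_below_in X B B'" "way_below_in X B' U" unfolding F_def by auto
    then have "A \<union> B \<in> F" unfolding F_def
      using way_below_Un[of X A A' B B'] way_below_Un[of X A' U B' U] by (auto intro!: exI[of _ "A' \<union> B'"])
    then show "\<exists>W\<in>F. A \<subseteq> W \<and> B \<subseteq> W" by blast
  qed
  moreover have "U \<subseteq> \<Union>F"
  proof
    fix x assume "x \<in> U"
    then obtain W where W: "openin X W" "way_below_in X W U" "x \<in> W"
      using directed_way_below(2)[OF cc U] by blast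
    then obtain A where "openin X A" "way_below_in X A W" "x \<in> A"
      using directed_way_below(2)[OF cc W(1)] by blast
    then show "x \<in> \<Union>F" using W unfolding F_def by blast
  qed
  moreover have "\<forall>W\<in>F. openin X W" unfolding F_def by simp
  ultimately obtain A where "A \<in> F" "V \<subseteq> A"
    using VU[unfolded way_below_in_def, rule_format, of F] by blast
  obtain W where W: "openin X W" "way_below_in X A W" "way_below_in X W U"
    using \<open>A \<in> F\<close> unfolding F_def by blast
  have "way_below_in X V W" by (rule way_below_mono[OF W(2) \<open>V \<subseteq> A\<close> order_refl])
  with W show ?thesis by blast
qed

text \<open>
  Repeated interpolation gives a sequence that decreases with respect to the way-below relation and stays above
  \<open>V\<close>; the open sets containing one of its terms form the filter. This replaces the choice of a compact
  set between \<open>V\<close> and \<open>U\<close>, which would need sobriety.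
\<close>

lemma scott_open_filter_between:
  assumes cc: "core_compact_space X" and U: "openin X U" and VU: "way_below_in X V U"
  shows "\<exists>F. scott_open_filter X F \<and> U \<in> F \<and> (\<forall>W\<in>F. V \<subseteq> W)"
proof -
  have "\<exists>f. \<forall>n. (openin X (f n) \<and> way_below_in X V (f n) \<and> way_below_in X (f n) U) \<and> way_below_in X (f (Suc n)) (f n)"
  proof (rule dependent_nat_choice)
    show "\<exists>W. openin X W \<and> way_below_in X V W \<and> way_below_in X W U"
      by (rule way_below_interpolate[OF cc U VU])
  next
    fix W n assume W: "openin X W \<and> way_below_in X V W \<and> way_below_in X W U"
    then obtain W' where "openin X W'" "way_below_in X V W'" "way_below_in X W' W"
      using way_below_interpolate[OF cc] by blast
    moreover have "way_below_in X W' U"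
      by (rule way_below_mono[OF calculation(3) order_refl]) (use way_below_imp_subset[OF _ U] W in simp)
    ultimately show "\<exists>W'. (openin X W' \<and> way_below_in X V W' \<and> way_below_in X W' U) \<and> way_below_in X W' W"
      by blast
  qed
  then obtain f where f: "\<And>n. openin X (f n)" "\<And>n. way_below_in X V (f n)" "\<And>n. way_below_in X (f n) U"
      "\<And>n. way_below_in X (f (Suc n)) (f n)" by blast
  define F where "F = {W. openin X W \<and> (\<exists>n. f n \<subseteq> W)}"
  have dec: "decseq f" by (rule decseq_SucI) (rule way_below_imp_subset[OF f(4) f(1)])
  have "scott_open_filter X F"
    unfolding scott_open_filter_def
  proof (intro conjI ballI allI impI)
    show "topspace X \<in> F" unfolding F_def using f(1) openin_subset by blast
    show "openin X W" if "W \<in> F" for W using that unfolding F_def by simp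
    show "W \<in> F" if "V \<in> F \<and> openin X W \<and> V \<subseteq> W" for V W using that unfolding F_def by blast
  next
    fix A B assume "A \<in> F" "B \<in> F"
    then obtain n k where "f n \<subseteq> A" "f k \<subseteq> B" "openin X A" "openin X B" unfolding F_def by blast
    then have "f (max n k) \<subseteq> A \<inter> B" using decseqD[OF dec, of n "max n k"] decseqD[OF dec, of k "max n k"] by auto
    then show "A \<inter> B \<in> F" unfolding F_def using \<open>openin X A\<close> \<open>openin X B\<close> by blast
  next
    fix D assume D: "(\<forall>W\<in>D. openin X W) \<and> directed_family D \<and> \<Union>D \<in> F"
    then obtain n where "f n \<subseteq> \<Union>D" unfolding F_def by blast
    with D f(4)[of n] obtain W where "W \<in> D" "f (Suc n) \<subseteq> W" unfolding way_below_in_def by blast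
    with D show "\<exists>W\<in>D. W \<in> F" unfolding F_def by blast
  qed
  moreover have "U \<in> F" unfolding F_def using U way_below_imp_subset[OF f(3) U] by blast
  moreover have "\<forall>W\<in>F. V \<subseteq> W" unfolding F_def using way_below_imp_subset[OF f(2) f(1)] by blast
  ultimately show ?thesis by blast
qed

lemma way_below_Un_split:
  assumes cc: "core_compact_space X" and U: "openin X U1" "openin X U2" and W: "way_below_in X W (U1 \<union> U2)"
  shows "\<exists>V1 V2. openin X V1 \<and> openin X V2 \<and> way_below_in X V1 U1 \<and> way_below_in X V2 U2 \<and> W \<subseteq> V1 \<union> V2"
proof -
  define F where "F = {V1 \<union> V2 |V1 V2. openin X V1 \<and> openin X V2 \<and> way_below_in X V1 U1 \<and> way_below_in X V2 U2}"
  have "directed_family F"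
    unfolding directed_family_def
  proof (intro conjI ballI)
    have "{} \<union> {} \<in> F" unfolding F_def mem_Collect_eq
      by (intro exI[of _ "{}"]) (simp add: way_below_empty)
    then show "F \<noteq> {}" by blast
    fix A B assume "A \<in> F" "B \<in> F"
    then obtain A1 A2 B1 B2 where *: "A = A1 \<union> A2" "B = B1 \<union> B2"
       "openin X A1" "openin X A2" "way_below_in X A1 U1" "way_below_in X A2 U2"
       "openin X B1" "openin X B2" "way_below_in X B1 U1" "way_below_in X B2 U2" unfolding F_def by auto
    have "(A1 \<union> B1) \<union> (A2 \<union> B2) \<in> F"
      unfolding F_def mem_Collect_eq
      by (rule exI[of _ "A1 \<union> B1"], rule exI[of _ "A2 \<union> B2"])
        (use *(3-) way_below_Un[of X A1 U1 B1 U1] way_below_Un[of X A2 U2 B2 U2] in \<open>simp add: openin_Un\<close>)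
    moreover have "A \<subseteq> (A1 \<union> B1) \<union> (A2 \<union> B2)" "B \<subseteq> (A1 \<union> B1) \<union> (A2 \<union> B2)"
      using *(1,2) by auto
    ultimately show "\<exists>W\<in>F. A \<subseteq> W \<and> B \<subseteq> W" by blast
  qed
  moreover have "U1 \<union> U2 \<subseteq> \<Union>F"
  proof
    fix x assume "x \<in> U1 \<union> U2"
    then consider "x \<in> U1" | "x \<in> U2" by blast
    then show "x \<in> \<Union>F"
    proof cases
      case 1
      then obtain V where "openin X V" "way_below_in X V U1" "x \<in> V"
        using directed_way_below(2)[OF cc U(1)] by blast
      then have "V \<union> {} \<in> F" unfolding F_def mem_Collect_eq using way_below_empty[of X U2] openin_empty[of X]
        by (intro exI[of _ V] exI[of _ "{}"]) simp
      then show ?thesis using \<open>x \<in> V\<close> by blast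
    next
      case 2
      then obtain V where "openin X V" "way_below_in X V U2" "x \<in> V"
        using directed_way_below(2)[OF cc U(2)] by blast
      then have "{} \<union> V \<in> F" unfolding F_def mem_Collect_eq using way_below_empty[of X U1] openin_empty[of X]
        by (intro exI[of _ V] exI[of _ "{}"]) simp
      then show ?thesis using \<open>x \<in> V\<close> by blast
    qed
  qed
  moreover have "\<forall>W\<in>F. openin X W" unfolding F_def by auto
  ultimately obtain A where "A \<in> F" "W \<subseteq> A"
    using W[unfolded way_below_in_def, rule_format, of F] by blast
  then obtain V1 V2 where "W \<subseteq> V1 \<union> V2" "openin X V1" "openin X V2" "way_below_in X V1 U1" "way_below_in X V2 U2"
    unfolding F_def by blast
  then show ?thesis by (intro exI[of _ V1] exI[of _ V2]) simp
qed

section \<open>Submodular capacities\<close>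

definition submodular_capacity :: "'a topology \<Rightarrow> ('a set \<Rightarrow> real) \<Rightarrow> bool" where
  "submodular_capacity X q \<longleftrightarrow> q {} = 0 \<and>
     (\<forall>U V. openin X U \<and> openin X V \<and> U \<subseteq> V \<longrightarrow> q U \<le> q V) \<and>
     (\<forall>U V. openin X U \<and> openin X V \<longrightarrow> q (U \<union> V) + q (U \<inter> V) \<le> q U + q V)"

lemma submodular_capacityD:
  assumes "submodular_capacity X q"
  shows "q {} = 0" and "openin X U \<Longrightarrow> openin X V \<Longrightarrow> U \<subseteq> V \<Longrightarrow> q U \<le> q V"
    and "openin X U \<Longrightarrow> openin X V \<Longrightarrow> q (U \<union> V) + q (U \<inter> V) \<le> q U + q V"
    and "openin X U \<Longrightarrow> 0 \<le> q U"
proof -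
  show "q {} = 0" using assms by (simp add: submodular_capacity_def)
  show mono: "openin X U \<Longrightarrow> openin X V \<Longrightarrow> U \<subseteq> V \<Longrightarrow> q U \<le> q V" for U V
    using assms by (simp add: submodular_capacity_def)
  show "openin X U \<Longrightarrow> openin X V \<Longrightarrow> q (U \<union> V) + q (U \<inter> V) \<le> q U + q V"
    using assms by (simp add: submodular_capacity_def)
  show "openin X U \<Longrightarrow> 0 \<le> q U" using mono[of "{}" U] \<open>q {} = 0\<close> by simp
qed

lemma submodular_capacity_cong:
  assumes "\<And>U. openin X U \<Longrightarrow> q U = q' U"
  shows "submodular_capacity X q \<longleftrightarrow> submodular_capacity X q'"
  using assms unfolding submodular_capacity_def by (simp add: openin_Un openin_Int cong: conj_cong imp_cong)

text \<open>
  Submodularity survives infima along downward directed families because both values on the right-hand side can be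
  approximated by the same member of the family. Subtracting the values at the empty set makes this applicable to
  families such as \<open>q (U \<union> W)\<close> with varying \<open>W\<close>, which do not vanish there.
\<close>

lemma submodular_capacity_INF_normalized:
  assumes ne: "I \<noteq> {}"
    and q: "\<And>i. i \<in> I \<Longrightarrow> submodular_capacity X (\<lambda>U. q i U - q i {})"
    and q0: "\<And>i. i \<in> I \<Longrightarrow> 0 \<le> q i {}"
    and dir: "\<And>i j. i \<in> I \<Longrightarrow> j \<in> I \<Longrightarrow> \<exists>k\<in>I. \<forall>U. openin X U \<longrightarrow> q k U \<le> q i U \<and> q k U \<le> q j U"
  shows "submodular_capacity X (\<lambda>U. (INF i\<in>I. q i U) - (INF i\<in>I. q i {}))"
proof -
  have bdd: "bdd_below ((\<lambda>i. q i U) ` I)" if "openin X U" for U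
  proof (rule bdd_belowI[of _ 0])
    fix x assume "x \<in> (\<lambda>i. q i U) ` I"
    then obtain i where i: "i \<in> I" "x = q i U" by blast
    show "0 \<le> x" using submodular_capacityD(4)[OF q[OF i(1)] that] q0[OF i(1)] i(2) by simp
  qed
  have mono: "(INF i\<in>I. q i U) \<le> (INF i\<in>I. q i V)" if "openin X U" "openin X V" "U \<subseteq> V" for U V
    by (rule cINF_mono[OF ne bdd]) (use that submodular_capacityD(2)[OF q, of _ U V] in auto)
  have "(INF i\<in>I. q i (U \<union> V)) + (INF i\<in>I. q i (U \<inter> V)) \<le> (INF i\<in>I. q i U) + (INF i\<in>I. q i V)"
    if UV: "openin X U \<and> openin X V" for U V
  proof (rule field_le_epsilon)
    fix e :: real assume e: "e > 0"
    have "\<exists>i\<in>I. q i U < (INF i\<in>I. q i U) + e/2"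
      using cINF_less_iff[OF ne bdd[of U], of "(INF i\<in>I. q i U) + e/2"] UV e by simp
    then obtain i where i: "i \<in> I" "q i U < (INF i\<in>I. q i U) + e/2" by blast
    have "\<exists>i\<in>I. q i V < (INF i\<in>I. q i V) + e/2"
      using cINF_less_iff[OF ne bdd[of V], of "(INF i\<in>I. q i V) + e/2"] UV e by simp
    then obtain j where j: "j \<in> I" "q j V < (INF i\<in>I. q i V) + e/2" by blast
    obtain k where k: "k \<in> I" "q k U \<le> q i U" "q k V \<le> q j V" using dir[OF i(1) j(1)] UV by blast
    have "(INF i\<in>I. q i (U \<union> V)) \<le> q k (U \<union> V)" "(INF i\<in>I. q i (U \<inter> V)) \<le> q k (U \<inter> V)"
      using UV by (auto intro!: cINF_lower bdd k(1))
    moreover have "q k (U \<union> V) + q k (U \<inter> V) \<le> q k U + q k V"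
      using submodular_capacityD(3)[OF q[OF k(1)], of U V] UV by simp
    ultimately show "(INF i\<in>I. q i (U \<union> V)) + (INF i\<in>I. q i (U \<inter> V)) \<le> (INF i\<in>I. q i U) + (INF i\<in>I. q i V) + e"
      using i j k by linarith
  qed
  then show ?thesis unfolding submodular_capacity_def using mono by simp
qed

lemma submodular_capacity_INF:
  assumes ne: "I \<noteq> {}"
    and q: "\<And>i. i \<in> I \<Longrightarrow> submodular_capacity X (q i)"
    and dir: "\<And>i j. i \<in> I \<Longrightarrow> j \<in> I \<Longrightarrow> \<exists>k\<in>I. \<forall>U. openin X U \<longrightarrow> q k U \<le> q i U \<and> q k U \<le> q j U"
  shows "submodular_capacity X (\<lambda>U. INF i\<in>I. q i U)"
proof -
  have q0: "q i {} = 0" if "i \<in> I" for i by (rule submodular_capacityD(1)[OF q[OF that]])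
  have "submodular_capacity X (\<lambda>U. (INF i\<in>I. q i U) - (INF i\<in>I. q i {}))"
    by (rule submodular_capacity_INF_normalized[OF ne _ _ dir]) (use q q0 in simp_all)
  moreover have "(INF i\<in>I. q i {}) = 0" using ne q0 by simp
  ultimately show ?thesis by simp
qed

lemma submodular_capacity_restrict:
  assumes q: "submodular_capacity X q" and W: "openin X W"
  shows "submodular_capacity X (\<lambda>U. q (U \<inter> W))"
  unfolding submodular_capacity_def
proof (intro conjI allI impI)
  show "q ({} \<inter> W) = 0" using submodular_capacityD(1)[OF q] by simp
  show "q (U \<inter> W) \<le> q (V \<inter> W)" if "openin X U \<and> openin X V \<and> U \<subseteq> V" for U V
    using that W by (intro submodular_capacityD(2)[OF q]) auto
  show "q ((U \<union> V) \<inter> W) + q (U \<inter> V \<inter> W) \<le> q (U \<inter> W) + q (V \<inter> W)" if "openin X U \<and> openin X V" for U V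
  proof -
    have "(U \<union> V) \<inter> W = U \<inter> W \<union> V \<inter> W" "U \<inter> V \<inter> W = (U \<inter> W) \<inter> (V \<inter> W)" by auto
    then show ?thesis using submodular_capacityD(3)[OF q, of "U \<inter> W" "V \<inter> W"] that W by auto
  qed
qed

lemma submodular_capacity_contract:
  assumes q: "submodular_capacity X q" and W: "openin X W"
  shows "submodular_capacity X (\<lambda>U. q (U \<union> W) - q W)"
  unfolding submodular_capacity_def
proof (intro conjI allI impI)
  show "q ({} \<union> W) - q W = 0" by simp
  show "q (U \<union> W) - q W \<le> q (V \<union> W) - q W" if "openin X U \<and> openin X V \<and> U \<subseteq> V" for U V
    using that W by (auto intro!: submodular_capacityD(2)[OF q])
  show "q (U \<union> V \<union> W) - q W + (q (U \<inter> V \<union> W) - q W) \<le> q (U \<union> W) - q W + (q (V \<union> W) - q W)" if "openin X U \<and> openin X V" for U V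
  proof -
    have "U \<union> V \<union> W = (U \<union> W) \<union> (V \<union> W)" "U \<inter> V \<union> W = (U \<union> W) \<inter> (V \<union> W)" by auto
    then show ?thesis using submodular_capacityD(3)[OF q, of "U \<union> W" "V \<union> W"] that W by auto
  qed
qed

lemma submodular_capacity_add:
  assumes "submodular_capacity X q" "submodular_capacity X q'"
  shows "submodular_capacity X (\<lambda>U. q U + q' U)"
  unfolding submodular_capacity_def
proof (intro conjI allI impI)
  show "q {} + q' {} = 0" using assms by (simp add: submodular_capacity_def)
  show "q U + q' U \<le> q V + q' V" if "openin X U \<and> openin X V \<and> U \<subseteq> V" for U V
    using that submodular_capacityD(2)[OF assms(1), of U V] submodular_capacityD(2)[OF assms(2), of U V] by auto
  show "q (U \<union> V) + q' (U \<union> V) + (q (U \<inter> V) + q' (U \<inter> V)) \<le> q U + q' U + (q V + q' V)" if "openin X U \<and> openin X V" for U V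
    using that submodular_capacityD(3)[OF assms(1), of U V] submodular_capacityD(3)[OF assms(2), of U V] by auto
qed

lemma submodular_capacity_scale:
  assumes "submodular_capacity X q" "t \<ge> 0"
  shows "submodular_capacity X (\<lambda>U. t * q U)"
  unfolding submodular_capacity_def
proof (intro conjI allI impI)
  show "t * q {} = 0" using assms by (simp add: submodular_capacity_def)
  show "t * q U \<le> t * q V" if "openin X U \<and> openin X V \<and> U \<subseteq> V" for U V
    using that submodular_capacityD(2)[OF assms(1), of U V] assms(2) by (auto intro: mult_left_mono)
  show "t * q (U \<union> V) + t * q (U \<inter> V) \<le> t * q U + t * q V" if "openin X U \<and> openin X V" for U V
    using that submodular_capacityD(3)[OF assms(1), of U V] assms(2) by (auto simp flip: distrib_left intro: mult_left_mono)
qed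

lemma submodular_capacity_min:
  assumes q: "submodular_capacity X q" and A: "A \<ge> 0"
  shows "submodular_capacity X (\<lambda>U. min (q U) A)"
  unfolding submodular_capacity_def
proof (intro conjI allI impI)
  show "min (q {}) A = 0" using assms by (simp add: submodular_capacity_def)
  show "min (q U) A \<le> min (q V) A" if "openin X U \<and> openin X V \<and> U \<subseteq> V" for U V
    using that submodular_capacityD(2)[OF q, of U V] by auto
  show "min (q (U \<union> V)) A + min (q (U \<inter> V)) A \<le> min (q U) A + min (q V) A" if "openin X U \<and> openin X V" for U V
  proof -
    have op: "openin X (U \<union> V)" "openin X (U \<inter> V)" using that by auto
    have "q (U \<union> V) + q (U \<inter> V) \<le> q U + q V" "q (U \<inter> V) \<le> q U" "q (U \<inter> V) \<le> q V"
      "q U \<le> q (U \<union> V)" "q V \<le> q (U \<union> V)"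
      using that op by (auto intro!: submodular_capacityD(2,3)[OF q])
    then show ?thesis by linarith
  qed
qed

text \<open>
  Subtracting a modular function preserves submodularity but may destroy monotonicity; the largest monotone
  function below repairs this.
\<close>

lemma submodular_capacity_monotone_hull:
  fixes p :: "'a set \<Rightarrow> real"
  assumes p0: "p {} = 0" and nonneg: "\<And>U. openin X U \<Longrightarrow> 0 \<le> p U"
    and sub: "\<And>U V. openin X U \<Longrightarrow> openin X V \<Longrightarrow> p (U \<union> V) + p (U \<inter> V) \<le> p U + p V"
  shows "submodular_capacity X (\<lambda>U. INF V\<in>{V. openin X V \<and> U \<subseteq> V}. p V)" (is "submodular_capacity X ?r")
    and "\<And>U. openin X U \<Longrightarrow> (INF V\<in>{V. openin X V \<and> U \<subseteq> V}. p V) \<le> p U"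
proof -
  have ne: "{V. openin X V \<and> U \<subseteq> V} \<noteq> {}" if "openin X U" for U using that by blast
  have bdd: "bdd_below (p ` {V. openin X V \<and> U \<subseteq> V})" for U
    by (rule bdd_belowI[of _ 0]) (use nonneg in auto)
  show le: "?r U \<le> p U" if "openin X U" for U
    by (rule cINF_lower[OF bdd]) (use that in auto)
  show "submodular_capacity X ?r"
    unfolding submodular_capacity_def
  proof (intro conjI allI impI)
    have "0 \<le> ?r {}" by (rule cINF_greatest[OF ne[OF openin_empty]]) (use nonneg in auto)
    then show "?r {} = 0" using le[OF openin_empty] p0 by simp
    show "?r U \<le> ?r V" if "openin X U \<and> openin X V \<and> U \<subseteq> V" for U V
      by (rule cINF_superset_mono[OF ne bdd]) (use that in auto)
    fix U1 U2 assume U: "openin X U1 \<and> openin X U2"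
    have *: "?r (U1 \<union> U2) + ?r (U1 \<inter> U2) \<le> p V1 + p V2"
      if V1: "V1 \<in> {V. openin X V \<and> U1 \<subseteq> V}" and V2: "V2 \<in> {V. openin X V \<and> U2 \<subseteq> V}" for V1 V2
    proof -
      have "?r (U1 \<union> U2) \<le> p (V1 \<union> V2)" by (rule cINF_lower[OF bdd]) (use V1 V2 in auto)
      moreover have "?r (U1 \<inter> U2) \<le> p (V1 \<inter> V2)" by (rule cINF_lower[OF bdd]) (use V1 V2 in auto)
      ultimately show ?thesis using sub[of V1 V2] V1 V2 by auto
    qed
    have "?r (U1 \<union> U2) + ?r (U1 \<inter> U2) - ?r U2 \<le> ?r U1"
    proof (rule cINF_greatest[OF ne])
      fix V1 assume V1: "V1 \<in> {V. openin X V \<and> U1 \<subseteq> V}"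
      have "?r (U1 \<union> U2) + ?r (U1 \<inter> U2) - p V1 \<le> ?r U2"
        by (rule cINF_greatest[OF ne]) (use U *[OF V1] in \<open>auto simp: algebra_simps\<close>)
      then show "?r (U1 \<union> U2) + ?r (U1 \<inter> U2) - ?r U2 \<le> p V1" by simp
    qed (use U in simp)
    then show "?r (U1 \<union> U2) + ?r (U1 \<inter> U2) \<le> ?r U1 + ?r U2" by simp
  qed
qed

text \<open>
  The lower regularization of a submodular capacity is again submodular: what lies way below a union splits into
  pieces way below the two parts, and what lies way below an intersection can be added to both pieces. The analogous
  inequality for supermodular functions would need the way-below relation to be stable under intersections.
  This is why the whole argument works with submodular functions and not with valuations alone.
\<close>

lemma submodular_capacity_regularize:
  assumes cc: "core_compact_space X" and q: "submodular_capacity X q"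
  shows "submodular_capacity X (\<lambda>U. SUP V\<in>{V. openin X V \<and> way_below_in X V U}. q V)"
proof -
  let ?B = "\<lambda>U. {V. openin X V \<and> way_below_in X V U}"
  have ne: "?B U \<noteq> {}" for U using way_below_empty[of X U] openin_empty[of X] by blast
  have bdd: "bdd_above (q ` ?B U)" if "openin X U" for U
  proof (rule bdd_aboveI[of _ "q U"])
    fix x assume "x \<in> q ` ?B U"
    then obtain V where "x = q V" "openin X V" "way_below_in X V U" by blast
    then show "x \<le> q U" using submodular_capacityD(2)[OF q _ that] way_below_imp_subset[OF _ that] by simp
  qed
  show ?thesis
    unfolding submodular_capacity_def
  proof (intro conjI allI impI)
    have "V = {}" if "way_below_in X V {}" for V
      using way_below_imp_subset[OF that openin_empty] by simp
    then have "?B {} = {{}}" by (auto simp: way_below_empty)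
    then show "(SUP V\<in>?B {}. q V) = 0" using submodular_capacityD(1)[OF q] by simp
    show "(SUP V\<in>?B U. q V) \<le> (SUP V\<in>?B U'. q V)" if "openin X U \<and> openin X U' \<and> U \<subseteq> U'" for U U'
      by (rule cSUP_subset_mono[OF ne bdd]) (use that way_below_mono[OF _ order_refl] in auto)
  next
    fix U1 U2 assume U: "openin X U1 \<and> openin X U2"
    show "(SUP V\<in>?B (U1 \<union> U2). q V) + (SUP V\<in>?B (U1 \<inter> U2). q V) \<le> (SUP V\<in>?B U1. q V) + (SUP V\<in>?B U2. q V)"
    proof -
      have *: "q W + q W' \<le> (SUP V\<in>?B U1. q V) + (SUP V\<in>?B U2. q V)"
        if W: "W \<in> ?B (U1 \<union> U2)" and W': "W' \<in> ?B (U1 \<inter> U2)" for W W'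
      proof -
        obtain V1 V2 where V: "openin X V1" "openin X V2" "way_below_in X V1 U1" "way_below_in X V2 U2" "W \<subseteq> V1 \<union> V2"
          using way_below_Un_split[OF cc, of U1 U2 W] U W by (metis mem_Collect_eq)
        have "V1 \<union> W' \<in> ?B U1" "V2 \<union> W' \<in> ?B U2"
          using W' V way_below_Un[of X V1 U1 W' "U1 \<inter> U2"] way_below_Un[of X V2 U2 W' "U1 \<inter> U2"]
          by (simp_all add: openin_Un Un_absorb2)
        then have "q (V1 \<union> W') \<le> (SUP V\<in>?B U1. q V)" "q (V2 \<union> W') \<le> (SUP V\<in>?B U2. q V)"
          using U by (auto intro!: cSUP_upper bdd)
        moreover have "q ((V1 \<union> W') \<union> (V2 \<union> W')) + q ((V1 \<union> W') \<inter> (V2 \<union> W')) \<le> q (V1 \<union> W') + q (V2 \<union> W')"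
          using W' V by (intro submodular_capacityD(3)[OF q]) auto
        moreover have "q W \<le> q ((V1 \<union> W') \<union> (V2 \<union> W'))" "q W' \<le> q ((V1 \<union> W') \<inter> (V2 \<union> W'))"
          using W W' V by (auto intro!: submodular_capacityD(2)[OF q])
        ultimately show ?thesis by linarith
      qed
      have "(SUP V\<in>?B (U1 \<union> U2). q V) \<le> (SUP V\<in>?B U1. q V) + (SUP V\<in>?B U2. q V) - (SUP V\<in>?B (U1 \<inter> U2). q V)"
      proof (rule cSUP_least[OF ne])
        fix W assume W: "W \<in> ?B (U1 \<union> U2)"
        have "(SUP V\<in>?B (U1 \<inter> U2). q V) \<le> (SUP V\<in>?B U1. q V) + (SUP V\<in>?B U2. q V) - q W"
          by (rule cSUP_least[OF ne]) (use *[OF W] in fastforce)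
        then show "q W \<le> (SUP V\<in>?B U1. q V) + (SUP V\<in>?B U2. q V) - (SUP V\<in>?B (U1 \<inter> U2). q V)" by simp
      qed
      then show ?thesis by simp
    qed
  qed
qed

text \<open>
  Zorn's lemma applies because infima of chains stay submodular. Minimality is what later forces modularity and
  Scott continuity. A function is normalized to \<open>0\<close> outside the open sets only to make the pointwise order
  antisymmetric.
\<close>

lemma minimal_submodular_capacity:
  assumes q: "submodular_capacity X q" and c: "\<And>U. openin X U \<Longrightarrow> c U \<le> q U"
  obtains m where "submodular_capacity X m" "\<And>U. openin X U \<Longrightarrow> c U \<le> m U" "\<And>U. openin X U \<Longrightarrow> m U \<le> q U"
    "\<And>m' U. \<lbrakk>submodular_capacity X m'; \<And>U. openin X U \<Longrightarrow> c U \<le> m' U; \<And>U. openin X U \<Longrightarrow> m' U \<le> m U; openin X U\<rbrakk>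
      \<Longrightarrow> m' U = m U"
proof -
  define A where "A = {m. submodular_capacity X m \<and> (\<forall>U. openin X U \<longrightarrow> c U \<le> m U \<and> m U \<le> q U)
      \<and> (\<forall>U. \<not> openin X U \<longrightarrow> m U = 0)}"
  define cut where "cut = (\<lambda>(m::'a set \<Rightarrow> real) U. if openin X U then m U else 0)"
  have cut: "cut m \<in> A" if "submodular_capacity X m" "\<And>U. openin X U \<Longrightarrow> c U \<le> m U" "\<And>U. openin X U \<Longrightarrow> m U \<le> q U" for m
    using that submodular_capacity_cong[of X "cut m" m] unfolding A_def by (simp add: cut_def)
  have "\<exists>m\<in>A. \<forall>a\<in>A. a \<le> m \<longrightarrow> a = m"
  proof (rule predicate_Zorn[where P = "\<lambda>a b. b \<le> a"])
    show "partial_order_on A (relation_of (\<lambda>a b. b \<le> a) A)"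
      by (rule partial_order_on_relation_ofI) auto
  next
    fix C assume C: "C \<in> Chains (relation_of (\<lambda>a b. b \<le> a) A)"
    have CA: "C \<subseteq> A" using C unfolding Chains_def relation_of_def by auto
    have tot: "a \<le> b \<or> b \<le> a" if "a \<in> C" "b \<in> C" for a b
      using C that unfolding Chains_def relation_of_def by auto
    show "\<exists>u\<in>A. \<forall>a\<in>C. u \<le> a"
    proof (cases "C = {}")
      case True
      then show ?thesis using cut[OF q c order_refl] by blast
    next
      case False
      define u where "u = (\<lambda>U. INF a\<in>C. a U)"
      have bdd: "bdd_below ((\<lambda>a. a U) ` C)" for U
        by (cases "openin X U", rule bdd_belowI[of _ "c U"], use CA in \<open>auto simp: A_def intro!: bdd_belowI[of _ 0]\<close>)
      have "submodular_capacity X u" unfolding u_def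
      proof (rule submodular_capacity_INF[OF False])
        show "submodular_capacity X a" if "a \<in> C" for a using that CA unfolding A_def by auto
        fix a b assume ab: "a \<in> C" "b \<in> C"
        show "\<exists>k\<in>C. \<forall>U. openin X U \<longrightarrow> k U \<le> a U \<and> k U \<le> b U"
          using tot[OF ab] ab by (auto simp: le_fun_def)
      qed
      moreover have "c U \<le> u U" if "openin X U" for U unfolding u_def
        by (rule cINF_greatest[OF False]) (use CA that in \<open>auto simp: A_def\<close>)
      moreover have ua: "u \<le> a" if "a \<in> C" for a
        unfolding u_def le_fun_def using cINF_lower[OF bdd that] by simp
      moreover have "u U \<le> q U" if "openin X U" for U
      proof -
        obtain a where "a \<in> C" using False by blast
        then have "u U \<le> a U" "a U \<le> q U" using ua CA that by (auto simp: le_fun_def A_def)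
        then show ?thesis by simp
      qed
      moreover have "u U = 0" if "\<not> openin X U" for U
      proof -
        have "a U = 0" if "a \<in> C" for a using that CA \<open>\<not> openin X U\<close> by (auto simp: A_def)
        then have "(\<lambda>a. a U) ` C = (\<lambda>a. 0) ` C" by (intro image_cong) auto
        then show ?thesis unfolding u_def using False by simp
      qed
      ultimately have "u \<in> A" unfolding A_def by blast
      with ua show ?thesis by blast
    qed
  qed
  then obtain m where m: "m \<in> A" "\<And>a. a \<in> A \<Longrightarrow> a \<le> m \<Longrightarrow> a = m" by blast
  show thesis
  proof (rule that[of m])
    show "submodular_capacity X m" using m(1) unfolding A_def by simp
    show "c U \<le> m U" "m U \<le> q U" if "openin X U" for U using m(1) that unfolding A_def by auto
    show "m' U = m U" if m': "submodular_capacity X m'" "\<And>U. openin X U \<Longrightarrow> c U \<le> m' U" "\<And>U. openin X U \<Longrightarrow> m' U \<le> m U" "openin X U" for m' U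
    proof -
      have "m' V \<le> q V" if "openin X V" for V using m'(3)[OF that] m(1) that unfolding A_def by force
      with cut[OF m'(1,2)] have "cut m' \<in> A" by blast
      moreover have "cut m' \<le> m" unfolding le_fun_def cut_def using m'(3) m(1) by (auto simp: A_def)
      ultimately have "cut m' = m" by (rule m(2))
      then show ?thesis using \<open>openin X U\<close> by (auto simp: cut_def)
    qed
  qed
qed

section \<open>Real-valued continuous valuations\<close>

definition real_valuation :: "'a topology \<Rightarrow> ('a set \<Rightarrow> real) \<Rightarrow> bool" where
  "real_valuation X m \<longleftrightarrow> submodular_capacity X m \<and>
     (\<forall>U V. openin X U \<and> openin X V \<longrightarrow> m (U \<union> V) + m (U \<inter> V) = m U + m V) \<and>
     (\<forall>D e. (\<forall>W\<in>D. openin X W) \<and> directed_family D \<and> e > 0 \<longrightarrow> (\<exists>W\<in>D. m (\<Union>D) < m W + e))"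

lemma real_valuationD:
  assumes "real_valuation X m"
  shows "submodular_capacity X m"
    and "openin X U \<Longrightarrow> openin X V \<Longrightarrow> m (U \<union> V) + m (U \<inter> V) = m U + m V"
    and "(\<And>W. W \<in> D \<Longrightarrow> openin X W) \<Longrightarrow> directed_family D \<Longrightarrow> e > 0 \<Longrightarrow> \<exists>W\<in>D. m (\<Union>D) < m W + e"
  using assms unfolding real_valuation_def by simp_all

lemma real_valuation_zero: "real_valuation X (\<lambda>_. 0)"
  unfolding real_valuation_def submodular_capacity_def directed_family_def by auto

lemma real_valuation_scale:
  assumes m: "real_valuation X m" and t: "t \<ge> 0"
  shows "real_valuation X (\<lambda>U. t * m U)"
proof (cases "t = 0")
  case True
  then show ?thesis using real_valuation_zero by simp
next
  case False
  have "\<exists>W\<in>D. t * m (\<Union>D) < t * m W + e" if D: "\<forall>W\<in>D. openin X W" "directed_family D" "e > 0" for D e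
  proof -
    obtain W where "W \<in> D" "m (\<Union>D) < m W + e / t"
      using real_valuationD(3)[OF m, of D "e / t"] D False t by auto
    then show ?thesis using False t by (intro bexI[of _ W]) (auto simp: field_simps)
  qed
  moreover have "t * m (U \<union> V) + t * m (U \<inter> V) = t * m U + t * m V" if "openin X U" "openin X V" for U V
    using real_valuationD(2)[OF m that] by (simp flip: distrib_left)
  ultimately show ?thesis
    unfolding real_valuation_def using submodular_capacity_scale[OF real_valuationD(1)[OF m] t] by blast
qed

lemma real_valuation_add:
  assumes m: "real_valuation X m" and n: "real_valuation X n"
  shows "real_valuation X (\<lambda>U. m U + n U)"
proof -
  have "\<exists>W\<in>D. m (\<Union>D) + n (\<Union>D) < m W + n W + e" if D: "\<forall>W\<in>D. openin X W" "directed_family D" "e > 0" for D e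
  proof -
    obtain V where V: "V \<in> D" "m (\<Union>D) < m V + e / 2"
      using real_valuationD(3)[OF m, of D "e / 2"] D by auto
    obtain V' where V': "V' \<in> D" "n (\<Union>D) < n V' + e / 2"
      using real_valuationD(3)[OF n, of D "e / 2"] D by auto
    obtain W where W: "W \<in> D" "V \<subseteq> W" "V' \<subseteq> W"
      using V(1) V'(1) D(2) unfolding directed_family_def by blast
    have "m V \<le> m W" "n V' \<le> n W"
      using W V(1) V'(1) D(1) submodular_capacityD(2)[OF real_valuationD(1)[OF m]]
        submodular_capacityD(2)[OF real_valuationD(1)[OF n]] by auto
    with V V' W show ?thesis by (intro bexI[of _ W]) auto
  qed
  moreover have "m (U \<union> V) + n (U \<union> V) + (m (U \<inter> V) + n (U \<inter> V)) = m U + n U + (m V + n V)"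
    if "openin X U" "openin X V" for U V
    using real_valuationD(2)[OF m that] real_valuationD(2)[OF n that] by linarith
  ultimately show ?thesis
    unfolding real_valuation_def
    using submodular_capacity_add[OF real_valuationD(1)[OF m] real_valuationD(1)[OF n]] by blast
qed

text \<open>
  The sandwich theorem for one filter. Take a minimal submodular capacity \<open>m\<close> that is at least \<open>1\<close> on
  \<open>F\<close>. Three constructions produce smaller competitors, so each of them must return \<open>m\<close> itself:
  the infimum of the restrictions of \<open>m\<close> to the members of \<open>F\<close>, which shows that \<open>m\<close> is carried by
  \<open>F\<close>; the sum of the restriction to \<open>W\<close> and the contraction by \<open>W\<close>, which then keeps the value
  \<open>1\<close> on \<open>F\<close> and shows that \<open>m\<close> is modular; and the lower regularization, which shows that
  \<open>m\<close> is Scott-continuous.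
\<close>

lemma real_valuation_below_on_filter:
  assumes cc: "core_compact_space X" and F: "scott_open_filter X F"
    and q: "submodular_capacity X q" and qF: "\<And>U. U \<in> F \<Longrightarrow> 1 \<le> q U"
  shows "\<exists>m. real_valuation X m \<and> (\<forall>U\<in>F. m U = 1) \<and> (\<forall>U. openin X U \<longrightarrow> m U \<le> q U)"
proof -
  define c where "c U = (if U \<in> F then 1 else 0::real)" for U
  have q1: "submodular_capacity X (\<lambda>U. min (q U) 1)" by (rule submodular_capacity_min[OF q]) simp
  have cq: "c U \<le> min (q U) 1" if "openin X U" for U
    unfolding c_def using qF submodular_capacityD(4)[OF q that] by simp
  obtain m where m: "submodular_capacity X m" "\<And>U. openin X U \<Longrightarrow> c U \<le> m U"
      "\<And>U. openin X U \<Longrightarrow> m U \<le> min (q U) 1"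
    and minimal: "\<And>m' U. \<lbrakk>submodular_capacity X m'; \<And>U. openin X U \<Longrightarrow> c U \<le> m' U; \<And>U. openin X U \<Longrightarrow> m' U \<le> m U; openin X U\<rbrakk>
      \<Longrightarrow> m' U = m U"
    using minimal_submodular_capacity[OF q1 cq] by blast
  have mF: "m U = 1" if "U \<in> F" for U
    using m(2,3)[OF scott_open_filterD(1)[OF F that]] that by (simp add: c_def)
  have above: "c U \<le> m' U" if "submodular_capacity X m'" "\<And>U. U \<in> F \<Longrightarrow> 1 \<le> m' U" "openin X U" for m' U
    using that(2) submodular_capacityD(4)[OF that(1,3)] by (simp add: c_def)
  have support: "m (W \<inter> U) = m W" if U: "U \<in> F" and W: "openin X W" for U W
  proof -
    let ?m = "\<lambda>W. INF U\<in>F. m (W \<inter> U)"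
    have op: "openin X U" if "U \<in> F" for U by (rule scott_open_filterD(1)[OF F that])
    have ne: "F \<noteq> {}" using scott_open_filterD(2)[OF F] by blast
    have bdd: "bdd_below ((\<lambda>U. m (W \<inter> U)) ` F)" if "openin X W" for W
      by (rule bdd_belowI[of _ 0]) (use that op submodular_capacityD(4)[OF m(1)] in auto)
    have sub: "submodular_capacity X ?m"
    proof (rule submodular_capacity_INF[OF ne])
      show "submodular_capacity X (\<lambda>W. m (W \<inter> U))" if "U \<in> F" for U
        by (rule submodular_capacity_restrict[OF m(1) op[OF that]])
      fix U V assume UV: "U \<in> F" "V \<in> F"
      show "\<exists>k\<in>F. \<forall>W. openin X W \<longrightarrow> m (W \<inter> k) \<le> m (W \<inter> U) \<and> m (W \<inter> k) \<le> m (W \<inter> V)"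
        by (rule bexI[of _ "U \<inter> V"])
          (use UV op scott_open_filterD(4)[OF F UV] in \<open>auto intro!: submodular_capacityD(2)[OF m(1)]\<close>)
    qed
    have "?m W = m W"
    proof (rule minimal[OF sub _ _ W])
      show "c W \<le> ?m W" if "openin X W" for W
      proof (rule above[OF sub _ that])
        fix V assume V: "V \<in> F"
        show "1 \<le> ?m V" by (rule cINF_greatest[OF ne]) (use mF[OF scott_open_filterD(4)[OF F V]] in simp)
      qed
      show "?m W \<le> m W" if "openin X W" for W
        by (rule cINF_lower2[OF bdd[OF that] scott_open_filterD(2)[OF F]])
          (use that openin_subset[OF that] in \<open>simp add: Int_absorb2\<close>)
    qed
    moreover have "?m W \<le> m (W \<inter> U)" by (rule cINF_lower[OF bdd[OF W] U])
    moreover have "m (W \<inter> U) \<le> m W" by (rule submodular_capacityD(2)[OF m(1)]) (use W op[OF U] in auto)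
    ultimately show ?thesis by simp
  qed
  have modular: "m (U \<union> W) + m (U \<inter> W) = m U + m W" if U: "openin X U" and W: "openin X W" for U W
  proof -
    let ?m = "\<lambda>U. m (U \<inter> W) + (m (U \<union> W) - m W)"
    have sub: "submodular_capacity X ?m"
      by (intro submodular_capacity_add submodular_capacity_restrict submodular_capacity_contract m(1) W)
    have "?m U = m U"
    proof (rule minimal[OF sub _ _ U])
      show "c U \<le> ?m U" if "openin X U" for U
      proof (rule above[OF sub _ that])
        fix V assume V: "V \<in> F"
        have "m (V \<inter> W) = m W" using support[OF V W] by (simp add: Int_commute)
        moreover have "V \<union> W \<in> F"
          by (rule scott_open_filterD(3)[OF F V]) (use W scott_open_filterD(1)[OF F V] in auto)
        ultimately show "1 \<le> ?m V" using mF by simp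
      qed
      show "?m U \<le> m U" if "openin X U" for U using submodular_capacityD(3)[OF m(1) that W] by simp
    qed
    then show ?thesis by simp
  qed
  have regular: "(SUP V\<in>{V. openin X V \<and> way_below_in X V U}. m V) = m U" if U: "openin X U" for U
  proof (rule minimal[OF submodular_capacity_regularize[OF cc m(1)] _ _ U])
    fix U assume U: "openin X U"
    let ?B = "{V. openin X V \<and> way_below_in X V U}"
    have le: "m V \<le> m U" if "V \<in> ?B" for V
      using that submodular_capacityD(2)[OF m(1) _ U] way_below_imp_subset[OF _ U] by simp
    have ne: "?B \<noteq> {}" using way_below_empty[of X U] openin_empty[of X] by blast
    show "(SUP V\<in>?B. m V) \<le> m U" by (rule cSUP_least[OF ne le])
    have bdd: "bdd_above (m ` ?B)" using le by (intro bdd_aboveI[of _ "m U"]) auto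
    show "c U \<le> (SUP V\<in>?B. m V)"
    proof (cases "U \<in> F")
      case True
      have "\<exists>V\<in>?B. V \<in> F"
        by (rule scott_open_filterD(5)[OF F]) (use directed_way_below[OF cc U] True in auto)
      then obtain V where V: "V \<in> ?B" "V \<in> F" by blast
      show ?thesis using cSUP_upper[OF V(1) bdd] mF[OF V(2)] True by (simp add: c_def)
    next
      case False
      show ?thesis using cSUP_upper[OF _ bdd, of "{}"] way_below_empty[of X U] False
        by (simp add: c_def submodular_capacityD(1)[OF m(1)])
    qed
  qed
  have "\<exists>W\<in>D. m (\<Union>D) < m W + e" if D: "\<forall>W\<in>D. openin X W" "directed_family D" and e: "e > 0" for D e
  proof -
    let ?B = "{V. openin X V \<and> way_below_in X V (\<Union>D)}"
    have opD: "openin X (\<Union>D)" using D by (auto intro: openin_Union)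
    have ne: "?B \<noteq> {}" using way_below_empty[of X "\<Union>D"] openin_empty[of X] by blast
    have "m (\<Union>D) - e < (SUP V\<in>?B. m V)" using regular[OF opD] e by simp
    then have "\<exists>V\<in>?B. m (\<Union>D) - e < m V" using less_cSupD[of "m ` ?B" "m (\<Union>D) - e"] ne by auto
    then obtain V where V: "V \<in> ?B" "m (\<Union>D) < m V + e" by force
    then obtain W where W: "W \<in> D" "V \<subseteq> W" using D unfolding way_below_in_def by auto
    then have "m V \<le> m W" using V D by (intro submodular_capacityD(2)[OF m(1)]) auto
    with V W show ?thesis by (intro bexI[of _ W]) auto
  qed
  then have "real_valuation X m" unfolding real_valuation_def using m(1) modular by blast
  moreover have "m U \<le> q U" if "openin X U" for U using m(3)[OF that] by simp
  ultimately show ?thesis using mF by blast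
qed

section \<open>The sandwich theorem\<close>

text \<open>
  A Scott-open filter plays the role of a compact saturated set (it is the neighbourhood filter of one when
  the space is sober). So \<open>filter_capacity a F J\<close> is the least mass that must be found inside an open set by
  a valuation spreading, for each \<open>j\<close>, the mass \<open>a j\<close> in an arbitrary way over the compact set
  encoded by \<open>F j\<close>. It is Scott-continuous and supermodular, but in general not modular.
\<close>

definition filter_capacity :: "('i \<Rightarrow> real) \<Rightarrow> ('i \<Rightarrow> 'a set set) \<Rightarrow> 'i set \<Rightarrow> 'a set \<Rightarrow> real" where
  "filter_capacity a F J U = (\<Sum>j\<in>J. if U \<in> F j then a j else 0)"

lemma filter_capacity_mono:
  assumes F: "\<And>j. j \<in> J \<Longrightarrow> scott_open_filter X (F j)" and a: "\<And>j. j \<in> J \<Longrightarrow> 0 \<le> a j"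
    and V: "openin X V" "U \<subseteq> V"
  shows "filter_capacity a F J U \<le> filter_capacity a F J V"
  unfolding filter_capacity_def
proof (rule sum_mono)
  fix j assume j: "j \<in> J"
  show "(if U \<in> F j then a j else 0) \<le> (if V \<in> F j then a j else 0)"
    using a[OF j] scott_open_filterD(3)[OF F[OF j] _ V] by auto
qed

lemma filter_capacity_split:
  assumes "finite J" "I \<subseteq> J"
  shows "filter_capacity a F J U = filter_capacity a F I U + filter_capacity a F (J - I) U"
  unfolding filter_capacity_def 
  by (subst sum.subset_diff[OF assms(2,1)]) (rule add.commute)

lemma filter_capacity_eq_sum:
  assumes "\<And>j. j \<in> J \<Longrightarrow> U \<in> F j" shows "filter_capacity a F J U = sum a J"
  unfolding filter_capacity_def using assms by (intro sum.cong) auto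

lemma filter_capacity_reweight:
  assumes "finite J" "k \<in> J"
  shows "filter_capacity (a(k := (1 - s) * a k)) F J U = filter_capacity a F J U - s * (if U \<in> F k then a k else 0)"
proof -
  have *: "filter_capacity b F J U = (if U \<in> F k then b k else 0) + filter_capacity b F (J - {k}) U" for b
    using filter_capacity_split[OF assms(1), of "{k}" b F U] assms(2) by (simp add: filter_capacity_def)
  have "filter_capacity (a(k := (1 - s) * a k)) F (J - {k}) U = filter_capacity a F (J - {k}) U"
    unfolding filter_capacity_def by (intro sum.cong) auto
  then show ?thesis using *[of a] *[of "a(k := (1 - s) * a k)"] by (auto simp: left_diff_distrib)
qed

text \<open>
  Induction on the set of filters. For one index \<open>k\<close> of positive weight, the case of a single filter gives a
  continuous valuation \<open>m \<le> q\<close> of total mass \<open>a k\<close> carried by \<open>F k\<close>. Subtract \<open>s * m\<close>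
  from \<open>q\<close> and \<open>s * a k\<close> from the \<open>k\<close>-th weight, with \<open>s\<close> as large as the inequality permits.
  If \<open>s = 1\<close>, the index \<open>k\<close> is used up. Otherwise the inequality becomes tight along the filter
  \<open>G\<close>, the intersection of the \<open>F j\<close> with \<open>j\<close> in some proper nonempty set \<open>I\<close> of indices.
  As in the marriage theorem, the problem then splits into one for \<open>I\<close>, restricted to \<open>G\<close>, and
  one for the other indices, contracted by \<open>G\<close>.
\<close>

theorem filter_capacity_sandwich:
  fixes J :: "'i set" and F :: "'i \<Rightarrow> 'a set set"
  assumes cc: "core_compact_space X" and J: "finite J"
    and F: "\<And>j. j \<in> J \<Longrightarrow> scott_open_filter X (F j)" and a: "\<And>j. j \<in> J \<Longrightarrow> 0 \<le> a j"
    and q: "submodular_capacity X q"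
    and above: "\<And>U. openin X U \<Longrightarrow> filter_capacity a F J U \<le> q U"
  shows "\<exists>m. real_valuation X m \<and> (\<forall>U. openin X U \<longrightarrow> filter_capacity a F J U \<le> m U \<and> m U \<le> q U)"
  using J F a q above
proof (induction J arbitrary: a q rule: finite_psubset_induct)
  case (psubset J)
  note finJ = psubset.hyps and FJ = psubset.prems(1) and aJ = psubset.prems(2)
    and subq = psubset.prems(3) and aboveq = psubset.prems(4)
  have IH: "\<exists>m. real_valuation X m \<and> (\<forall>U. openin X U \<longrightarrow> filter_capacity b F I U \<le> m U \<and> m U \<le> p U)"
    if "I \<subset> J" "\<And>j. j \<in> J \<Longrightarrow> 0 \<le> b j" "submodular_capacity X p" "\<And>U. openin X U \<Longrightarrow> filter_capacity b F I U \<le> p U"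
    for I b p
    by (rule psubset.IH[OF that(1) _ _ that(3,4)]) (use that(1,2) FJ in auto)
  show ?case
  proof (cases "\<forall>j\<in>J. a j = 0")
    case True
    then have "filter_capacity a F J U = 0" for U
      unfolding filter_capacity_def by (intro sum.neutral) auto
    then show ?thesis
      by (intro exI[of _ "\<lambda>_. 0"]) (simp add: real_valuation_zero submodular_capacityD(4)[OF subq])
  next
    case False
    then obtain k where k: "k \<in> J" "a k > 0" using aJ by force
    have Fk: "scott_open_filter X (F k)" by (rule FJ[OF k(1)])
    have "1 \<le> 1 / a k * q U" if U: "U \<in> F k" for U
    proof -
      have "a k \<le> filter_capacity a F J U"
        unfolding filter_capacity_def
        using member_le_sum[of k J "\<lambda>j. if U \<in> F j then a j else 0"] k U finJ aJ by auto
      then have "a k \<le> q U" using aboveq[OF scott_open_filterD(1)[OF Fk U]] by simp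
      then show ?thesis using k by simp
    qed
    then obtain m1 where m1: "real_valuation X m1" "\<And>U. U \<in> F k \<Longrightarrow> m1 U = 1"
        "\<And>U. openin X U \<Longrightarrow> m1 U \<le> 1 / a k * q U"
      using real_valuation_below_on_filter[OF cc Fk submodular_capacity_scale[OF subq, of "1 / a k"]] k by auto
    define m where "m U = a k * m1 U" for U
    have m: "real_valuation X m" unfolding m_def by (rule real_valuation_scale[OF m1(1)]) (use k in simp)
    have m_sub: "submodular_capacity X m" by (rule real_valuationD(1)[OF m])
    have m_nonneg: "0 \<le> m U" if "openin X U" for U by (rule submodular_capacityD(4)[OF m_sub that])
    have mF: "m U = a k" if "U \<in> F k" for U using m1(2)[OF that] by (simp add: m_def)
    have mq: "m U \<le> q U" if "openin X U" for U
      using m1(3)[OF that] k by (simp add: m_def field_simps)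
    have m_le: "m U \<le> a k" if U: "openin X U" for U
      using submodular_capacityD(2)[OF m_sub U openin_topspace openin_subset[OF U]]
        mF[OF scott_open_filterD(2)[OF Fk]] by simp
    define g where "g U = (if U \<in> F k then a k else 0)" for U
    have gm: "g U \<le> m U" if "openin X U" for U using mF m_nonneg[OF that] by (simp add: g_def)
    define b where "b s = a(k := (1 - s) * a k)" for s
    have b_eq: "filter_capacity (b s) F J U = filter_capacity a F J U - s * g U" for s U
      unfolding b_def g_def by (rule filter_capacity_reweight[OF finJ k(1)])
    have b_nonneg: "0 \<le> b s j" if "s \<le> 1" "j \<in> J" for s j using that aJ k by (simp add: b_def)
    \<comment> \<open>\<open>T\<close> is a closed set of parameters, so its supremum \<open>s\<close> is attained.\<close>
    define T where "T = {s. 0 \<le> s \<and> s \<le> 1 \<and> (\<forall>U. openin X U \<longrightarrow> filter_capacity a F J U - s * g U \<le> q U - s * m U)}"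
    define s where "s = Sup T"
    have T0: "0 \<in> T" unfolding T_def using aboveq by simp
    have bddT: "bdd_above T" by (rule bdd_aboveI[of _ 1]) (simp add: T_def)
    have "closed T"
    proof -
      have "T = {0..1} \<inter> (\<Inter>U\<in>{U. openin X U}. {s. filter_capacity a F J U - s * g U \<le> q U - s * m U})"
        unfolding T_def by auto
      moreover have "closed {s. filter_capacity a F J U - s * g U \<le> q U - s * m U}" for U
        by (intro closed_Collect_le continuous_intros)
      ultimately show ?thesis by (simp add: closed_INT closed_Int)
    qed
    then have "s \<in> T" unfolding s_def using closed_contains_Sup[of T] T0 bddT by blast
    then have s: "0 \<le> s" "s \<le> 1"
      and s_above: "\<And>U. openin X U \<Longrightarrow> filter_capacity a F J U - s * g U \<le> q U - s * m U"
      unfolding T_def by auto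
    have s_max: "t \<notin> T" if "s < t" for t
      using cSup_upper[OF _ bddT, of t] that unfolding s_def by force
    define p where "p U = q U - s * m U" for U
    have sm_le: "s * m U \<le> m U" if "openin X U" for U
      using mult_right_mono[OF s(2) m_nonneg[OF that]] by simp
    have p_nonneg: "0 \<le> p U" if "openin X U" for U
      using sm_le[OF that] mq[OF that] by (simp add: p_def)
    have p_sub: "p (U \<union> V) + p (U \<inter> V) \<le> p U + p V" if "openin X U" "openin X V" for U V
    proof -
      have "s * m (U \<union> V) + s * m (U \<inter> V) = s * m U + s * m V"
        using real_valuationD(2)[OF m that] by (simp flip: distrib_left)
      then show ?thesis using submodular_capacityD(3)[OF subq that] by (simp add: p_def)
    qed
    have p0: "p {} = 0" using submodular_capacityD(1)[OF subq] submodular_capacityD(1)[OF m_sub] by (simp add: p_def)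
    define r where "r U = (INF V\<in>{V. openin X V \<and> U \<subseteq> V}. p V)" for U
    have r: "submodular_capacity X r" and rp: "\<And>U. openin X U \<Longrightarrow> r U \<le> p U"
      using submodular_capacity_monotone_hull[OF p0 p_nonneg p_sub] unfolding r_def by auto
    have br: "filter_capacity (b s) F J U \<le> r U" if U: "openin X U" for U
      unfolding r_def
    proof (rule cINF_greatest)
      show "{V. openin X V \<and> U \<subseteq> V} \<noteq> {}" using U by blast
      fix V assume V: "V \<in> {V. openin X V \<and> U \<subseteq> V}"
      have "filter_capacity (b s) F J U \<le> filter_capacity (b s) F J V"
        by (rule filter_capacity_mono[OF FJ]) (use V b_nonneg[OF s(2)] in auto)
      also have "\<dots> \<le> p V" unfolding b_eq p_def using s_above V by simp
      finally show "filter_capacity (b s) F J U \<le> p V" .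
    qed
    have combine: ?thesis
      if n: "real_valuation X n" "\<And>U. openin X U \<Longrightarrow> filter_capacity (b s) F J U \<le> n U"
        "\<And>U. openin X U \<Longrightarrow> n U \<le> r U" for n
    proof (intro exI conjI allI impI)
      show "real_valuation X (\<lambda>U. s * m U + n U)"
        by (rule real_valuation_add[OF real_valuation_scale[OF m s(1)] n(1)])
      fix U assume U: "openin X U"
      show "filter_capacity a F J U \<le> s * m U + n U"
        using n(2)[OF U] mult_left_mono[OF gm[OF U] s(1)] by (simp add: b_eq)
      show "s * m U + n U \<le> q U" using n(3)[OF U] rp[OF U] by (simp add: p_def)
    qed
    show ?thesis
    proof (cases "s = 1")
      case True
      have eq: "filter_capacity (b s) F J U = filter_capacity (b s) F (J - {k}) U" for U
        using filter_capacity_split[OF finJ, of "{k}" "b s" F U] k(1) True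
        by (simp add: filter_capacity_def b_def)
      have "\<exists>n. real_valuation X n \<and> (\<forall>U. openin X U \<longrightarrow> filter_capacity (b s) F (J - {k}) U \<le> n U \<and> n U \<le> r U)"
        by (rule IH[OF _ b_nonneg[OF s(2)] r]) (use k br eq in auto)
      then show ?thesis using combine eq by auto
    next
      case False
      \<comment> \<open>Beyond \<open>s\<close> the inequality fails at sets whose profile omits \<open>k\<close>, since on members of \<open>F k\<close> both
        sides decrease at the same rate. There are finitely many profiles, so one of them, called \<open>I\<close>, occurs for
        parameters arbitrarily close to \<open>s\<close>.\<close>
      define prof where "prof W = {j \<in> J. W \<in> F j}" for W
      have viol: "\<exists>W. openin X W \<and> k \<notin> prof W \<and> q W - t * m W < sum a (prof W)" if t: "s < t" "t \<le> 1" for t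
      proof -
        obtain W where W: "openin X W" "q W - t * m W < filter_capacity a F J W - t * g W"
          using s_max[OF t(1)] t s(1) unfolding T_def by force
        have "W \<notin> F k"
        proof
          assume "W \<in> F k"
          then have "m W = g W" using mF by (simp add: g_def)
          then show False using W(2) s_above[OF W(1)] by simp
        qed
        moreover have "filter_capacity a F J W = sum a (prof W)"
          unfolding filter_capacity_def prof_def by (rule sum.inter_filter[OF finJ, symmetric])
        ultimately show ?thesis using W by (intro exI[of _ W]) (auto simp: prof_def g_def)
      qed
      define t where "t n = s + (1 - s) / (real n + 1)" for n
      have t: "s < t n" "t n \<le> 1" for n
      proof -
        have "0 < 1 - s" using False s by simp
        then show "s < t n" by (simp add: t_def)
        have "(1 - s) / (real n + 1) \<le> (1 - s) / 1" by (rule divide_left_mono) (use s in auto)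
        then show "t n \<le> 1" by (simp add: t_def)
      qed
      obtain w where w: "\<And>n. openin X (w n)" "\<And>n. k \<notin> prof (w n)"
          "\<And>n. q (w n) - t n * m (w n) < sum a (prof (w n))"
        using viol[OF t] by metis
      have "finite (range (\<lambda>n. prof (w n)))"
        by (rule finite_subset[of _ "Pow J"]) (use finJ in \<open>auto simp: prof_def\<close>)
      then obtain n0 where n0: "infinite {n. prof (w n) = prof (w n0)}"
        using pigeonhole_infinite[of "UNIV :: nat set" "\<lambda>n. prof (w n)"] by auto
      define I where "I = prof (w n0)"
      have IJ: "I \<subseteq> J" and kI: "k \<notin> I" using w(2)[of n0] by (auto simp: I_def prof_def)
      have "I \<noteq> {}"
      proof
        assume "I = {}"
        then have "q (w n0) - t n0 * m (w n0) < 0" using w(3)[of n0] by (simp add: I_def)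
        moreover have "t n0 * m (w n0) \<le> m (w n0)"
          using mult_right_mono[OF t(2) m_nonneg[OF w(1)]] by simp
        ultimately show False using mq[OF w(1)[of n0]] by simp
      qed
      \<comment> \<open>The inequality need not be an equality at any single open set; it is tight only in the limit along \<open>G\<close>.\<close>
      define G where "G = {W. openin X W \<and> (\<forall>j\<in>I. W \<in> F j)}"
      have tight: "\<exists>W\<in>G. r W < sum a I + e" if e: "e > 0" for e
      proof -
        have "(\<lambda>n. ((1 - s) * a k) * inverse (real (Suc n))) \<longlonglongrightarrow> 0"
          by (rule tendsto_mult_right_zero[OF LIMSEQ_inverse_real_of_nat])
        then have "(\<lambda>n. (1 - s) / (real n + 1) * a k) \<longlonglongrightarrow> 0"
          by (simp add: field_simps)
        then have "eventually (\<lambda>n. (1 - s) / (real n + 1) * a k < e) sequentially"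
          by (rule order_tendstoD(2)) (rule e)
        then obtain N where N: "\<And>n. n \<ge> N \<Longrightarrow> (1 - s) / (real n + 1) * a k < e"
          unfolding eventually_sequentially by blast
        obtain n where n: "n \<ge> N" "prof (w n) = I"
          using n0 unfolding I_def infinite_nat_iff_unbounded_le by blast
        have "(t n - s) * m (w n) \<le> (t n - s) * a k"
          using t(1)[of n] m_le[OF w(1)] by (intro mult_left_mono) auto
        also have "\<dots> < e" using N[OF n(1)] by (simp add: t_def)
        finally have "p (w n) < sum a I + e"
          using w(3)[of n] n(2) by (simp add: p_def algebra_simps)
        then have "r (w n) < sum a I + e" using rp[OF w(1)] by (rule le_less_trans[rotated])
        moreover have "w n \<in> G" using w(1) n(2) by (auto simp: G_def prof_def)
        ultimately show ?thesis by blast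
      qed
      have opG: "openin X W" if "W \<in> G" for W using that by (simp add: G_def)
      have GF: "W \<in> F j" if "W \<in> G" "j \<in> I" for W j using that by (simp add: G_def)
      have FI: "scott_open_filter X (F j)" if "j \<in> I" for j using that IJ FJ by blast
      have GInt: "V \<inter> W \<in> G" if "V \<in> G" "W \<in> G" for V W
        using that scott_open_filterD(4)[OF FI] by (auto simp: G_def)
      have neG: "G \<noteq> {}" using tight[of 1] by auto
      have bI: "sum (b s) I = sum a I" using kI by (intro sum.cong) (auto simp: b_def)
      have split: "filter_capacity (b s) F J U = filter_capacity (b s) F I U + filter_capacity (b s) F (J - I) U" for U
        by (rule filter_capacity_split[OF finJ IJ])
      have rest_nonneg: "0 \<le> filter_capacity (b s) F (J - I) U" for U
        unfolding filter_capacity_def using b_nonneg[OF s(2)] by (intro sum_nonneg) auto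
      have r_ge: "sum a I + filter_capacity (b s) F (J - I) W \<le> r W" if W: "openin X W" "\<And>j. j \<in> I \<Longrightarrow> W \<in> F j" for W
        using br[OF W(1)] filter_capacity_eq_sum[OF W(2), where J = I and a = "b s"] by (simp add: split bI)
      have bdd: "bdd_below ((\<lambda>W. r (h W)) ` G)" if "\<And>W. W \<in> G \<Longrightarrow> openin X (h W)" for h
        by (rule bdd_belowI[of _ 0]) (use that submodular_capacityD(4)[OF r] in auto)
      have INF_r: "(INF W\<in>G. r W) = sum a I"
      proof (rule antisym)
        show "(INF W\<in>G. r W) \<le> sum a I"
        proof (rule field_le_epsilon)
          fix e :: real assume "e > 0"
          then obtain W where "W \<in> G" "r W < sum a I + e" using tight by blast
          then show "(INF W\<in>G. r W) \<le> sum a I + e"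
            by (intro cINF_lower2[OF bdd[of "\<lambda>W. W"]]) (auto intro: opG)
        qed
        show "sum a I \<le> (INF W\<in>G. r W)"
          by (rule cINF_greatest[OF neG]) (use r_ge[OF opG GF] rest_nonneg in \<open>smt (verit, best)\<close>)
      qed
      \<comment> \<open>Restriction to and contraction by the filter \<open>G\<close>, understood as limits.\<close>
      define r1 where "r1 U = (INF W\<in>G. r (U \<inter> W))" for U
      define r2 where "r2 U = (INF W\<in>G. r (U \<union> W)) - (INF W\<in>G. r ({} \<union> W))" for U
      have sub1: "submodular_capacity X r1" unfolding r1_def
      proof (rule submodular_capacity_INF[OF neG])
        show "submodular_capacity X (\<lambda>U. r (U \<inter> W))" if "W \<in> G" for W
          by (rule submodular_capacity_restrict[OF r opG[OF that]])
        fix V W assume VW: "V \<in> G" "W \<in> G"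
        show "\<exists>k\<in>G. \<forall>U. openin X U \<longrightarrow> r (U \<inter> k) \<le> r (U \<inter> V) \<and> r (U \<inter> k) \<le> r (U \<inter> W)"
          using opG[OF VW(1)] opG[OF VW(2)]
          by (intro bexI[OF _ GInt[OF VW]]) (auto intro!: submodular_capacityD(2)[OF r])
      qed
      have sub2: "submodular_capacity X r2" unfolding r2_def
      proof (rule submodular_capacity_INF_normalized[OF neG])
        show "submodular_capacity X (\<lambda>U. r (U \<union> W) - r ({} \<union> W))" if "W \<in> G" for W
          using submodular_capacity_contract[OF r opG[OF that]] by simp
        show "0 \<le> r ({} \<union> W)" if "W \<in> G" for W using submodular_capacityD(4)[OF r opG[OF that]] by simp
        fix V W assume VW: "V \<in> G" "W \<in> G"
        show "\<exists>k\<in>G. \<forall>U. openin X U \<longrightarrow> r (U \<union> k) \<le> r (U \<union> V) \<and> r (U \<union> k) \<le> r (U \<union> W)"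
          using opG[OF VW(1)] opG[OF VW(2)]
          by (intro bexI[OF _ GInt[OF VW]]) (auto intro!: submodular_capacityD(2)[OF r])
      qed
      have above1: "filter_capacity (b s) F I U \<le> r1 U" if U: "openin X U" for U
        unfolding r1_def
      proof (rule cINF_greatest[OF neG])
        fix W assume W: "W \<in> G"
        have UW: "openin X (U \<inter> W)" using U opG[OF W] by blast
        have "U \<inter> W \<in> F j \<longleftrightarrow> U \<in> F j" if "j \<in> I" for j
          using scott_open_filterD(3)[OF FI[OF that], of "U \<inter> W" U] scott_open_filterD(4)[OF FI[OF that] _ GF[OF W that]] U by blast
        then have "filter_capacity (b s) F I U = filter_capacity (b s) F I (U \<inter> W)"
          unfolding filter_capacity_def by (intro sum.cong) auto
        then show "filter_capacity (b s) F I U \<le> r (U \<inter> W)"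
          using br[OF UW] rest_nonneg[of "U \<inter> W"] by (simp add: split)
      qed
      have above2: "filter_capacity (b s) F (J - I) U \<le> r2 U" if U: "openin X U" for U
      proof -
        have "sum a I + filter_capacity (b s) F (J - I) U \<le> (INF W\<in>G. r (U \<union> W))"
        proof (rule cINF_greatest[OF neG])
          fix W assume W: "W \<in> G"
          have UW: "openin X (U \<union> W)" using U opG[OF W] by blast
          have "U \<union> W \<in> F j" if "j \<in> I" for j
            by (rule scott_open_filterD(3)[OF FI[OF that] GF[OF W that] UW]) blast
          then have "sum a I + filter_capacity (b s) F (J - I) (U \<union> W) \<le> r (U \<union> W)" by (rule r_ge[OF UW])
          moreover have "filter_capacity (b s) F (J - I) U \<le> filter_capacity (b s) F (J - I) (U \<union> W)"
            by (rule filter_capacity_mono[OF FJ _ UW]) (use b_nonneg[OF s(2)] in auto)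
          ultimately show "sum a I + filter_capacity (b s) F (J - I) U \<le> r (U \<union> W)" by simp
        qed
        then show ?thesis by (simp add: r2_def INF_r)
      qed
      have r12: "r1 U + r2 U \<le> r U" if U: "openin X U" for U
      proof -
        have "r1 U + (INF W\<in>G. r (U \<union> W)) - r U \<le> (INF W\<in>G. r W)"
        proof (rule cINF_greatest[OF neG])
          fix W assume W: "W \<in> G"
          have "r1 U \<le> r (U \<inter> W)" unfolding r1_def
            by (rule cINF_lower[OF bdd W]) (use U opG in auto)
          moreover have "(INF W\<in>G. r (U \<union> W)) \<le> r (U \<union> W)"
            by (rule cINF_lower[OF bdd W]) (use U opG in auto)
          ultimately show "r1 U + (INF W\<in>G. r (U \<union> W)) - r U \<le> r W"
            using submodular_capacityD(3)[OF r U opG[OF W]] by simp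
        qed
        then show ?thesis by (simp add: r2_def)
      qed
      obtain n1 where n1: "real_valuation X n1" "\<And>U. openin X U \<Longrightarrow> filter_capacity (b s) F I U \<le> n1 U \<and> n1 U \<le> r1 U"
        using IH[OF _ b_nonneg[OF s(2)] sub1 above1] IJ kI k(1) by blast
      obtain n2 where n2: "real_valuation X n2" "\<And>U. openin X U \<Longrightarrow> filter_capacity (b s) F (J - I) U \<le> n2 U \<and> n2 U \<le> r2 U"
        using IH[OF _ b_nonneg[OF s(2)] sub2 above2] IJ \<open>I \<noteq> {}\<close> by blast
      show ?thesis
      proof (rule combine[OF real_valuation_add[OF n1(1) n2(1)]])
        fix U assume U: "openin X U"
        show "filter_capacity (b s) F J U \<le> n1 U + n2 U" using n1(2)[OF U] n2(2)[OF U] by (simp add: split)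
        show "n1 U + n2 U \<le> r U" using n1(2)[OF U] n2(2)[OF U] r12[OF U] by simp
      qed
    qed
  qed
qed

section \<open>Continuous valuations and the weak topology\<close>

lemma continuous_valuationsD:
  assumes "\<nu> \<in> continuous_valuations X"
  shows "\<nu> \<in> extensional {U. openin X U}" and "\<nu> {} = 0"
    and "openin X U \<Longrightarrow> openin X V \<Longrightarrow> \<nu> U + \<nu> V = \<nu> (U \<union> V) + \<nu> (U \<inter> V)"
    and "openin X U \<Longrightarrow> openin X V \<Longrightarrow> U \<subseteq> V \<Longrightarrow> \<nu> U \<le> \<nu> V"
    and "(\<And>W. W \<in> D \<Longrightarrow> openin X W) \<Longrightarrow> directed_family D \<Longrightarrow> \<nu> (\<Union>D) = (SUP W\<in>D. \<nu> W)"
  using assms unfolding continuous_valuations_def by simp_all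

lemma continuous_valuationsI:
  assumes "\<nu> \<in> extensional {U. openin X U}" and "\<nu> {} = 0"
    and "\<And>U V. openin X U \<Longrightarrow> openin X V \<Longrightarrow> \<nu> U + \<nu> V = \<nu> (U \<union> V) + \<nu> (U \<inter> V)"
    and "\<And>U V. openin X U \<Longrightarrow> openin X V \<Longrightarrow> U \<subseteq> V \<Longrightarrow> \<nu> U \<le> \<nu> V"
    and "\<And>D. (\<And>W. W \<in> D \<Longrightarrow> openin X W) \<Longrightarrow> directed_family D \<Longrightarrow> \<nu> (\<Union>D) = (SUP W\<in>D. \<nu> W)"
  shows "\<nu> \<in> continuous_valuations X"
  using assms unfolding continuous_valuations_def by simp

lemma real_valuation_imp_continuous_valuation:
  assumes m: "real_valuation X m"
  shows "(\<lambda>U\<in>{U. openin X U}. ennreal (m U)) \<in> continuous_valuations X"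
proof (rule continuous_valuationsI)
  note sub = real_valuationD(1)[OF m]
  let ?\<nu> = "\<lambda>U\<in>{U. openin X U}. ennreal (m U)"
  show "?\<nu> {} = 0" using submodular_capacityD(1)[OF sub] by simp
  show mono: "?\<nu> U \<le> ?\<nu> V" if "openin X U" "openin X V" "U \<subseteq> V" for U V
    using submodular_capacityD(2)[OF sub that] that by (simp add: ennreal_leI)
  show "?\<nu> U + ?\<nu> V = ?\<nu> (U \<union> V) + ?\<nu> (U \<inter> V)" if "openin X U" "openin X V" for U V
  proof -
    have op: "openin X (U \<union> V)" "openin X (U \<inter> V)" using that by auto
    have "ennreal (m U) + ennreal (m V) = ennreal (m (U \<union> V)) + ennreal (m (U \<inter> V))"
      using real_valuationD(2)[OF m that] submodular_capacityD(4)[OF sub] that op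
      by (simp flip: ennreal_plus)
    then show ?thesis using that op by simp
  qed
  show "?\<nu> (\<Union>D) = (SUP W\<in>D. ?\<nu> W)" if D: "\<And>W. W \<in> D \<Longrightarrow> openin X W" "directed_family D" for D
  proof (rule antisym)
    have opD: "openin X (\<Union>D)" using D(1) by (auto intro: openin_Union)
    show "(SUP W\<in>D. ?\<nu> W) \<le> ?\<nu> (\<Union>D)"
      by (rule SUP_least) (rule mono[OF D(1) opD], auto)
    show "?\<nu> (\<Union>D) \<le> (SUP W\<in>D. ?\<nu> W)"
    proof (rule ennreal_le_epsilon)
      fix e :: real assume e: "e > 0"
      obtain W where W: "W \<in> D" "m (\<Union>D) < m W + e" using real_valuationD(3)[OF m D e] by blast
      have "?\<nu> (\<Union>D) \<le> ennreal (m W + e)" using W(2) opD by (simp add: ennreal_leI)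
      also have "\<dots> = ?\<nu> W + ennreal e"
        using D(1)[OF W(1)] submodular_capacityD(4)[OF sub D(1)[OF W(1)]] e by simp
      also have "\<dots> \<le> (SUP W\<in>D. ?\<nu> W) + ennreal e" by (intro add_right_mono SUP_upper W(1))
      finally show "?\<nu> (\<Union>D) \<le> (SUP W\<in>D. ?\<nu> W) + ennreal e" .
    qed
  qed
qed simp

text \<open>
  The truncation of a modular function at a constant is submodular. Infinite values have to be treated separately
  because the modular law cannot be solved for one of its terms there.
\<close>

lemma truncated_modular_le:
  fixes w x y z :: ennreal
  assumes "x + y = z + w" "w \<le> x" "w \<le> y" "x \<le> z" "y \<le> z" and A: "0 \<le> A"
  shows "enn2real (min z (ennreal A)) + enn2real (min w (ennreal A)) \<le> enn2real (min x (ennreal A)) + enn2real (min y (ennreal A))"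
proof -
  define t where "t x = enn2real (min x (ennreal A))" for x :: ennreal
  have t_top: "t top = A" using A by (simp add: t_def)
  have t_mono: "t u \<le> t v" if "u \<le> v" for u v
    unfolding t_def by (rule enn2real_mono) (use that in \<open>auto intro: min.coboundedI1 simp: min_less_iff_disj\<close>)
  have t_real: "t (ennreal u) = min u A" if "0 \<le> u" for u
    using that A by (simp add: t_def min_def ennreal_le_iff)
  consider "x = top" | "y = top" | "x \<noteq> top" "y \<noteq> top" by blast
  then have "t z + t w \<le> t x + t y"
  proof cases
    case 1
    then have "z = top" using assms(4) by (simp add: top_unique)
    then show ?thesis using 1 t_mono[OF assms(3)] by simp
  next
    case 2
    then have "z = top" using assms(5) by (simp add: top_unique)
    then show ?thesis using 2 t_mono[OF assms(2)] by simp
  next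
    case 3
    then have "z \<noteq> top" "w \<noteq> top" using assms(1) by (auto simp: top_add)
    with 3 obtain x' y' z' w' where r: "x = ennreal x'" "y = ennreal y'" "z = ennreal z'" "w = ennreal w'"
      "0 \<le> x'" "0 \<le> y'" "0 \<le> z'" "0 \<le> w'" by (metis ennreal_cases)
    have "x' + y' = z' + w'" "w' \<le> x'" "w' \<le> y'" "x' \<le> z'" "y' \<le> z'"
      using assms(1-5) r by (simp_all flip: ennreal_plus)
    then have "min z' A + min w' A \<le> min x' A + min y' A" by linarith
    then show ?thesis using r by (simp add: t_real)
  qed
  then show ?thesis unfolding t_def .
qed

lemma submodular_capacity_truncate_valuation:
  assumes \<nu>: "\<nu> \<in> continuous_valuations X" and A: "0 \<le> A"
  shows "submodular_capacity X (\<lambda>U. enn2real (min (\<nu> U) (ennreal A)))"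
  unfolding submodular_capacity_def
proof (intro conjI allI impI)
  note D = continuous_valuationsD[OF \<nu>]
  show "enn2real (min (\<nu> {}) (ennreal A)) = 0" using D(2) by simp
  show "enn2real (min (\<nu> U) (ennreal A)) \<le> enn2real (min (\<nu> V) (ennreal A))"
    if "openin X U \<and> openin X V \<and> U \<subseteq> V" for U V
    by (rule enn2real_mono) (use that D(4)[of U V] in \<open>auto intro: min.coboundedI1 simp: min_less_iff_disj\<close>)
  show "enn2real (min (\<nu> (U \<union> V)) (ennreal A)) + enn2real (min (\<nu> (U \<inter> V)) (ennreal A))
      \<le> enn2real (min (\<nu> U) (ennreal A)) + enn2real (min (\<nu> V) (ennreal A))" if UV: "openin X U \<and> openin X V" for U V
  proof -
    have op: "openin X (U \<union> V)" "openin X (U \<inter> V)" using UV by auto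
    show ?thesis by (rule truncated_modular_le) (use UV op A in \<open>auto intro!: D(3,4)\<close>)
  qed
qed

definition weak_basic_set :: "'a topology \<Rightarrow> ('a set \<times> real) set \<Rightarrow> ('a set \<Rightarrow> ennreal) set" where
  "weak_basic_set X P = {\<nu> \<in> continuous_valuations X. \<forall>(U, r)\<in>P. \<nu> U > ennreal r}"

lemma openin_weak_basic_set:
  assumes "finite P" "\<And>U r. (U, r) \<in> P \<Longrightarrow> openin X U \<and> 0 \<le> r"
  shows "openin (valuation_space X) (weak_basic_set X P)"
proof -
  have top: "openin (valuation_space X) (continuous_valuations X)"
    unfolding valuation_space_def by (rule topology_generated_by_Basis) simp
  have "openin (valuation_space X) {\<nu> \<in> continuous_valuations X. \<nu> U > ennreal r}" if "openin X U" "0 \<le> r" for U r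
    unfolding valuation_space_def by (rule topology_generated_by_Basis) (use that in blast)
  then have "openin (valuation_space X) (\<Inter>(U, r)\<in>P. {\<nu> \<in> continuous_valuations X. \<nu> U > ennreal r})" if "P \<noteq> {}"
    using assms that by (intro openin_INT2) auto
  moreover have "weak_basic_set X P = (\<Inter>(U, r)\<in>P. {\<nu> \<in> continuous_valuations X. \<nu> U > ennreal r})" if "P \<noteq> {}"
    using that unfolding weak_basic_set_def by auto
  moreover have "weak_basic_set X {} = continuous_valuations X" unfolding weak_basic_set_def by simp
  ultimately show ?thesis using top by (cases "P = {}") auto
qed

lemma weak_basic_set_base:
  assumes "openin (valuation_space X) S" "\<nu> \<in> S"
  shows "\<exists>P. finite P \<and> (\<forall>(U, r)\<in>P. openin X U \<and> 0 \<le> r) \<and> \<nu> \<in> weak_basic_set X P \<and> weak_basic_set X P \<subseteq> S"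
proof -
  have "generate_topology_on (insert (continuous_valuations X)
       {{\<nu> \<in> continuous_valuations X. \<nu> U > ennreal r} | U r. openin X U \<and> r \<ge> 0}) S"
    using assms(1) unfolding valuation_space_def by (rule openin_topology_generated_by)
  then show ?thesis using assms(2)
  proof (induction arbitrary: \<nu> rule: generate_topology_on.induct)
    case Empty
    then show ?case by simp
  next
    case (Int S T)
    from Int.prems have "\<nu> \<in> S" "\<nu> \<in> T" by simp_all
    from Int.IH(1)[OF this(1)] Int.IH(2)[OF this(2)]
    obtain P R where P: "finite P" "\<forall>(U, r)\<in>P. openin X U \<and> 0 \<le> r" "\<nu> \<in> weak_basic_set X P" "weak_basic_set X P \<subseteq> S"
      and R: "finite R" "\<forall>(U, r)\<in>R. openin X U \<and> 0 \<le> r" "\<nu> \<in> weak_basic_set X R" "weak_basic_set X R \<subseteq> T"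
      by (elim exE conjE)
    have "weak_basic_set X (P \<union> R) = weak_basic_set X P \<inter> weak_basic_set X R"
      unfolding weak_basic_set_def by (auto simp: ball_Un)
    then show ?case using P R by (intro exI[of _ "P \<union> R"]) auto
  next
    case (UN K)
    then obtain k where k: "k \<in> K" "\<nu> \<in> k" by (elim UnionE)
    have "k \<subseteq> \<Union>K" using k(1) by (rule Union_upper)
    with UN.IH[OF k] show ?case by (meson order_trans)
  next
    case (Basis S)
    from Basis(1) consider "S = continuous_valuations X" | U r where "openin X U" "0 \<le> r" "S = {\<nu> \<in> continuous_valuations X. \<nu> U > ennreal r}"
      by auto
    then show ?case
    proof cases
      case 1
      then show ?thesis using Basis by (intro exI[of _ "{}"]) (simp add: weak_basic_set_def)
    next
      case 2
      then show ?thesis using Basis by (intro exI[of _ "{(U, r)}"]) (simp add: weak_basic_set_def)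
    qed
  qed
qed

section \<open>Compact sets of valuations\<close>

definition valuations_above :: "'a topology \<Rightarrow> ('a set \<Rightarrow> real) \<Rightarrow> ('a set \<Rightarrow> ennreal) set" where
  "valuations_above X c = {\<nu> \<in> continuous_valuations X. \<forall>U. openin X U \<longrightarrow> ennreal (c U) \<le> \<nu> U}"

text \<open>
  Tychonoff's theorem: all conditions are closed in the product topology on real functions. The corresponding
  set of Scott-continuous functions need not be closed.
\<close>

lemma compact_bounded_submodular_capacities:
  "compact {q. submodular_capacity X q \<and> (\<forall>U. 0 \<le> q U \<and> q U \<le> A) \<and> (\<forall>U. openin X U \<longrightarrow> c U \<le> q U)}"
proof -
  have co: "continuous_on UNIV (\<lambda>q::'a set \<Rightarrow> real. q U)" for U by (rule continuous_on_product_coordinates)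
  have "compactin (product_topology (\<lambda>U::'a set. euclidean) UNIV) (\<Pi>\<^sub>E U\<in>UNIV. {0..A})"
    by (subst compactin_PiE) simp
  then have comp: "compact (\<Pi>\<^sub>E U\<in>(UNIV::'a set set). {0..A})"
    by (simp add: euclidean_product_topology)
  have closed_le: "closed {q::'a set \<Rightarrow> real. P \<longrightarrow> q U \<le> q V}" for P U V
    by (cases P) (simp_all add: closed_Collect_le[OF co co])
  have closed_sub: "closed {q::'a set \<Rightarrow> real. P \<longrightarrow> q U + q V \<le> q W + q Z}" for P U V W Z
    by (cases P) (simp_all add: closed_Collect_le[OF continuous_on_add[OF co co] continuous_on_add[OF co co]])
  have closed_above: "closed {q::'a set \<Rightarrow> real. P \<longrightarrow> c U \<le> q U}" for P U
    by (cases P) (simp_all add: closed_Collect_le[OF continuous_on_const co])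
  have "closed {q::'a set \<Rightarrow> real. q {} = 0}" by (rule closed_Collect_eq[OF co continuous_on_const])
  then have "closed {q. submodular_capacity X q}"
    unfolding submodular_capacity_def
    by (intro closed_Collect_conj closed_Collect_all closed_le closed_sub)
  moreover have "closed {q::'a set \<Rightarrow> real. \<forall>U. openin X U \<longrightarrow> c U \<le> q U}"
    by (intro closed_Collect_all closed_above)
  ultimately have "compact ((\<Pi>\<^sub>E U\<in>UNIV. {0..A}) \<inter> ({q. submodular_capacity X q} \<inter> {q. \<forall>U. openin X U \<longrightarrow> c U \<le> q U}))"
    by (intro compact_Int_closed[OF comp] closed_Int)
  moreover have "(\<Pi>\<^sub>E U\<in>UNIV. {0..A}) \<inter> ({q. submodular_capacity X q} \<inter> {q. \<forall>U. openin X U \<longrightarrow> c U \<le> q U})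
    = {q. submodular_capacity X q \<and> (\<forall>U. 0 \<le> q U \<and> q U \<le> A) \<and> (\<forall>U. openin X U \<longrightarrow> c U \<le> q U)}"
    by (auto simp: PiE_iff)
  ultimately show ?thesis by simp
qed

text \<open>
  The compact set of bounded submodular capacities above \<open>c\<close> dominates the set of valuations above
  \<open>c\<close>, in both directions: by the sandwich theorem every such capacity has a continuous valuation above
  \<open>c\<close> below it, and every valuation above \<open>c\<close> becomes such a capacity when truncated at the total weight.
  Weakly open sets are upper sets, so a cover of the valuations lifts to a cover of the capacities, and a finite
  subcover descends again.
\<close>

theorem compactin_valuations_above_filter_capacity:
  fixes J :: "'i set" and F :: "'i \<Rightarrow> 'a set set"
  assumes cc: "core_compact_space X" and J: "finite J"
    and F: "\<And>j. j \<in> J \<Longrightarrow> scott_open_filter X (F j)" and a: "\<And>j. j \<in> J \<Longrightarrow> 0 \<le> a j"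
  shows "compactin (valuation_space X) (valuations_above X (filter_capacity a F J))"
  unfolding compactin_def
proof (intro conjI allI impI)
  let ?c = "filter_capacity a F J" and ?A = "sum a J"
  show "valuations_above X ?c \<subseteq> topspace (valuation_space X)"
    by (auto simp: valuations_above_def topspace_valuation_space)
  fix \<U> assume \<U>: "Ball \<U> (openin (valuation_space X)) \<and> valuations_above X ?c \<subseteq> \<Union>\<U>"
  define S where "S = {q. submodular_capacity X q \<and> (\<forall>U. 0 \<le> q U \<and> q U \<le> ?A) \<and> (\<forall>U. openin X U \<longrightarrow> ?c U \<le> q U)}"
  define \<P> where "\<P> = {P. finite P \<and> (\<forall>(U, r)\<in>P. 0 \<le> r) \<and> (\<exists>C\<in>\<U>. weak_basic_set X P \<subseteq> C)}"
  define f where "f P = {q::'a set \<Rightarrow> real. \<forall>(U, r)\<in>P. r < q U}" for P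
  have cA: "?c U \<le> ?A" for U unfolding filter_capacity_def using a by (intro sum_mono) auto
  have A: "0 \<le> ?A" by (rule sum_nonneg[OF a])
  have opf: "open (f P)" if "P \<in> \<P>" for P
  proof -
    have fin: "finite P" using that by (simp add: \<P>_def)
    have "f P = (\<Inter>p\<in>P. {q. snd p < q (fst p)})" by (rule set_eqI) (simp add: f_def case_prod_beta)
    moreover have "open {q::'a set \<Rightarrow> real. snd p < q (fst p)}" for p
      by (intro open_Collect_less continuous_intros continuous_on_product_coordinates)
    ultimately show ?thesis using fin by (simp add: open_INT)
  qed
  have cover: "S \<subseteq> (\<Union>P\<in>\<P>. f P)"
  proof
    fix q assume q: "q \<in> S"
    then have "submodular_capacity X q" "\<And>U. openin X U \<Longrightarrow> ?c U \<le> q U" by (simp_all add: S_def)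
    from filter_capacity_sandwich[OF cc J F a this]
    obtain m where m: "real_valuation X m" "\<And>U. openin X U \<Longrightarrow> ?c U \<le> m U \<and> m U \<le> q U" by metis
    define \<nu> where "\<nu> = (\<lambda>U\<in>{U. openin X U}. ennreal (m U))"
    have "\<nu> \<in> valuations_above X ?c"
      unfolding valuations_above_def \<nu>_def
      using real_valuation_imp_continuous_valuation[OF m(1)] m(2) by (simp add: ennreal_leI)
    then obtain C where C: "C \<in> \<U>" "\<nu> \<in> C" using \<U> by blast
    then have "openin (valuation_space X) C" using \<U> by blast
    from weak_basic_set_base[OF this C(2)]
    obtain P where P: "finite P" "\<forall>(U, r)\<in>P. openin X U \<and> 0 \<le> r" "\<nu> \<in> weak_basic_set X P" "weak_basic_set X P \<subseteq> C"
      by (elim exE conjE)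
    have "q \<in> f P" unfolding f_def
    proof safe
      fix U r assume Ur: "(U, r) \<in> P"
      then have U: "openin X U" "0 \<le> r" "ennreal r < \<nu> U" using P(2,3) unfolding weak_basic_set_def by auto
      then have "r < m U" unfolding \<nu>_def by (simp add: ennreal_less_iff)
      then show "r < q U" using m(2)[OF U(1)] by simp
    qed
    moreover have "P \<in> \<P>" using P C unfolding \<P>_def by blast
    ultimately show "q \<in> (\<Union>P\<in>\<P>. f P)" by blast
  qed
  obtain \<P>' where \<P>': "\<P>' \<subseteq> \<P>" "finite \<P>'" "S \<subseteq> (\<Union>P\<in>\<P>'. f P)"
    using compactE_image[OF compact_bounded_submodular_capacities[of X ?A ?c, folded S_def] opf cover] by blast
  have "\<forall>P\<in>\<P>'. \<exists>C. C \<in> \<U> \<and> weak_basic_set X P \<subseteq> C" using \<P>'(1) unfolding \<P>_def by blast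
  then obtain C where C: "\<And>P. P \<in> \<P>' \<Longrightarrow> C P \<in> \<U> \<and> weak_basic_set X P \<subseteq> C P" by metis
  have "valuations_above X ?c \<subseteq> \<Union>(C ` \<P>')"
  proof
    fix \<mu> assume \<mu>: "\<mu> \<in> valuations_above X ?c"
    then have \<mu>CV: "\<mu> \<in> continuous_valuations X" and \<mu>c: "\<And>U. openin X U \<Longrightarrow> ennreal (?c U) \<le> \<mu> U"
      unfolding valuations_above_def by auto
    define q where "q U = enn2real (min (\<mu> U) (ennreal ?A))" for U
    have q: "ennreal (q U) = min (\<mu> U) (ennreal ?A)" for U
      unfolding q_def by (rule ennreal_enn2real) (simp add: min_less_iff_disj)
    have "submodular_capacity X q"
      unfolding q_def by (rule submodular_capacity_truncate_valuation[OF \<mu>CV A])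
    moreover have "0 \<le> q U" "q U \<le> ?A" for U
      using q[of U] A by (auto simp: q_def intro!: enn2real_leI)
    moreover have "?c U \<le> q U" if "openin X U" for U
    proof -
      have "ennreal (?c U) \<le> ennreal (q U)" unfolding q using \<mu>c[OF that] cA by (simp add: ennreal_leI)
      then show ?thesis using \<open>0 \<le> q U\<close> by (simp add: ennreal_le_iff)
    qed
    ultimately have "q \<in> S" unfolding S_def by blast
    then obtain P where P: "P \<in> \<P>'" "q \<in> f P" using \<P>'(3) by blast
    have "ennreal r < \<mu> U" if "(U, r) \<in> P" for U r
    proof -
      have "0 \<le> r" using P(1) \<P>'(1) that unfolding \<P>_def by auto
      moreover have "r < q U" using P(2) that unfolding f_def by auto
      ultimately have "ennreal r < ennreal (q U)" by (simp add: ennreal_lessI)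
      then show ?thesis unfolding q by simp
    qed
    then have "\<mu> \<in> weak_basic_set X P" using \<mu>CV unfolding weak_basic_set_def by auto
    then show "\<mu> \<in> \<Union>(C ` \<P>')" using C[OF P(1)] P(1) by blast
  qed
  then show "\<exists>\<F>. finite \<F> \<and> \<F> \<subseteq> \<U> \<and> valuations_above X ?c \<subseteq> \<Union>\<F>"
    using \<P>'(2) C by (intro exI[of _ "C ` \<P>'"]) auto
qed

section \<open>Compact neighbourhoods of a valuation\<close>

text \<open>
  The mass of \<open>E\<close> is what \<open>\<nu>\<close> gives to the part of \<open>E\<close> outside all other members
  of \<open>L\<close> that precede it, for an enumeration of \<open>L\<close> in which smaller sets come first. These parts are
  disjoint differences of open sets, which explains the inequality, and those inside \<open>U\<close> exhaust
  \<open>U \<inter> \<Union>L\<close> when \<open>U\<close> meets every member of \<open>L\<close> in a member of \<open>L\<close>.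
\<close>

lemma valuation_masses_on_Int_closed_family:
  assumes \<nu>: "\<nu> \<in> continuous_valuations X" and L: "finite L" "\<And>E. E \<in> L \<Longrightarrow> openin X E"
    "\<And>E E'. E \<in> L \<Longrightarrow> E' \<in> L \<Longrightarrow> E \<inter> E' \<in> L"
  shows "\<exists>b. \<forall>U. openin X U \<longrightarrow> sum b {E \<in> L. E \<subseteq> U} \<le> \<nu> (U \<inter> \<Union>L) \<and>
      ((\<forall>E\<in>L. U \<inter> E \<in> L) \<longrightarrow> sum b {E \<in> L. E \<subseteq> U} = \<nu> (U \<inter> \<Union>L))"
  using L
proof (induction L rule: finite_psubset_induct)
  case (psubset L)
  note D = continuous_valuationsD[OF \<nu>]
  show ?case
  proof (cases "L = {}")
    case True
    then show ?thesis by (simp add: D(2))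
  next
    case False
    obtain M where M: "M \<in> L" "\<And>E. E \<in> L \<Longrightarrow> M \<subseteq> E \<Longrightarrow> M = E"
      using finite_has_maximal[OF psubset.hyps False] by metis
    define L' where "L' = L - {M}"
    define G where "G = \<Union>L'"
    have L': "L' \<subset> L" "finite L'" using M(1) psubset.hyps by (auto simp: L'_def)
    have UnL: "\<Union>L = G \<union> M" using M(1) by (auto simp: L'_def G_def)
    have opL': "openin X E" if "E \<in> L'" for E using psubset.prems(1) that by (simp add: L'_def)
    have IntL': "E \<inter> E' \<in> L'" if "E \<in> L'" "E' \<in> L'" for E E'
    proof -
      have "E \<inter> E' \<noteq> M"
      proof
        assume "E \<inter> E' = M"
        then have "M = E" using M(2)[of E] that(1) by (auto simp: L'_def)
        then show False using that(1) by (simp add: L'_def)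
      qed
      then show ?thesis using psubset.prems(2) that by (simp add: L'_def)
    qed
    have "\<exists>b. \<forall>U. openin X U \<longrightarrow> sum b {E \<in> L'. E \<subseteq> U} \<le> \<nu> (U \<inter> G) \<and>
        ((\<forall>E\<in>L'. U \<inter> E \<in> L') \<longrightarrow> sum b {E \<in> L'. E \<subseteq> U} = \<nu> (U \<inter> G))"
      unfolding G_def by (rule psubset.IH[OF L'(1)]) (fact opL', fact IntL')
    then obtain b' where b': "\<forall>U. openin X U \<longrightarrow> sum b' {E \<in> L'. E \<subseteq> U} \<le> \<nu> (U \<inter> G) \<and>
        ((\<forall>E\<in>L'. U \<inter> E \<in> L') \<longrightarrow> sum b' {E \<in> L'. E \<subseteq> U} = \<nu> (U \<inter> G))" by (elim exE)
    have b'_le: "sum b' {E \<in> L'. E \<subseteq> U} \<le> \<nu> (U \<inter> G)" if "openin X U" for U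
      using b'[rule_format, OF that] by simp
    have b'_eq: "sum b' {E \<in> L'. E \<subseteq> U} = \<nu> (U \<inter> G)" if "openin X U" "\<And>E. E \<in> L' \<Longrightarrow> U \<inter> E \<in> L'" for U
      using b'[rule_format, OF that(1)] that(2) by simp
    have opG: "openin X G" unfolding G_def using opL' by blast
    have opM: "openin X M" using psubset.prems(1) M(1) by blast
    \<comment> \<open>If \<open>\<nu> (M \<inter> G)\<close> is infinite then so is every value that the mass of \<open>M\<close> could complete, so
      \<open>0\<close> is as good as any other mass.\<close>
    define b where "b = b'(M := if \<nu> (M \<inter> G) = top then 0 else \<nu> M - \<nu> (M \<inter> G))"
    have sum_L': "sum b {E \<in> L'. E \<subseteq> U} = sum b' {E \<in> L'. E \<subseteq> U}" for U
      by (intro sum.cong) (auto simp: b_def L'_def)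
    have sum_out: "sum b {E \<in> L. E \<subseteq> U} = sum b' {E \<in> L'. E \<subseteq> U}" if "\<not> M \<subseteq> U" for U
    proof -
      have "{E \<in> L. E \<subseteq> U} = {E \<in> L'. E \<subseteq> U}" using that by (auto simp: L'_def)
      then show ?thesis using sum_L' by simp
    qed
    have sum_in: "sum b {E \<in> L. E \<subseteq> U} = sum b' {E \<in> L'. E \<subseteq> U} + b M" if "M \<subseteq> U" for U
    proof -
      have "{E \<in> L. E \<subseteq> U} = insert M {E \<in> L'. E \<subseteq> U}" using that M(1) by (auto simp: L'_def)
      moreover have "M \<notin> {E \<in> L'. E \<subseteq> U}" by (simp add: L'_def)
      ultimately show ?thesis using L'(2) sum_L'[of U] by (simp add: add.commute)
    qed
    have step: "\<nu> (U \<inter> G) + b M = \<nu> (U \<inter> \<Union>L)" if U: "openin X U" and MU: "M \<subseteq> U" for U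
    proof -
      have op: "openin X (U \<inter> G)" "openin X (M \<inter> G)" "openin X (U \<inter> \<Union>L)" using U opG opM by (auto simp: UnL)
      have "(U \<inter> G) \<union> M = U \<inter> \<Union>L" "(U \<inter> G) \<inter> M = M \<inter> G" using MU by (auto simp: UnL)
      then have eq: "\<nu> (U \<inter> G) + \<nu> M = \<nu> (U \<inter> \<Union>L) + \<nu> (M \<inter> G)" using D(3)[OF op(1) opM] by simp
      show ?thesis
      proof (cases "\<nu> (M \<inter> G) = top")
        case True
        have "\<nu> (M \<inter> G) \<le> \<nu> (U \<inter> G)" "\<nu> (M \<inter> G) \<le> \<nu> (U \<inter> \<Union>L)"
          using op MU by (auto intro!: D(4) simp: UnL)
        then show ?thesis using True by (simp add: top_unique)
      next
        case False
        have "\<nu> (M \<inter> G) \<le> \<nu> M" using op opM by (intro D(4)) auto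
        then have "\<nu> (U \<inter> G) + (\<nu> M - \<nu> (M \<inter> G)) = (\<nu> (U \<inter> G) + \<nu> M) - \<nu> (M \<inter> G)"
          by (rule add_diff_eq_ennreal)
        also have "\<dots> = \<nu> (U \<inter> \<Union>L)" unfolding eq using False by (rule ennreal_add_diff_cancel_right)
        finally show ?thesis using False by (simp add: b_def)
      qed
    qed
    show ?thesis
    proof (intro exI[of _ b] allI impI conjI)
      fix U assume U: "openin X U"
      show "sum b {E \<in> L. E \<subseteq> U} \<le> \<nu> (U \<inter> \<Union>L)"
      proof (cases "M \<subseteq> U")
        case True
        then show ?thesis using add_right_mono[OF b'_le[OF U], of "b M"] by (simp add: sum_in step[OF U])
      next
        case False
        have "\<nu> (U \<inter> G) \<le> \<nu> (U \<inter> \<Union>L)" using U opG opM by (intro D(4)) (auto simp: UnL)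
        then show ?thesis using b'_le[OF U] False by (simp add: sum_out)
      qed
      assume stable: "\<forall>E\<in>L. U \<inter> E \<in> L"
      have "U \<inter> E \<in> L'" if "E \<in> L'" for E
      proof -
        have "U \<inter> E \<noteq> M"
        proof
          assume "U \<inter> E = M"
          then have "M = E" using M(2)[of E] that by (auto simp: L'_def)
          then show False using that by (simp add: L'_def)
        qed
        then show ?thesis using stable that by (simp add: L'_def)
      qed
      then have eq: "sum b' {E \<in> L'. E \<subseteq> U} = \<nu> (U \<inter> G)" by (rule b'_eq[OF U])
      show "sum b {E \<in> L. E \<subseteq> U} = \<nu> (U \<inter> \<Union>L)"
      proof (cases "M \<subseteq> U")
        case True
        then show ?thesis using step[OF U] eq by (simp add: sum_in)
      next
        case False
        have "U \<inter> M \<in> L'" using stable M(1) False by (auto simp: L'_def)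
        then have "U \<inter> M \<subseteq> G" unfolding G_def by (rule Union_upper)
        then have "U \<inter> G = U \<inter> \<Union>L" by (auto simp: UnL)
        then show ?thesis using eq False by (simp add: sum_out)
      qed
    qed
  qed
qed

text \<open>
  The strict inequality for nonzero masses leaves room for a second approximation, that of the carrying sets.
\<close>

lemma approximate_masses_from_below:
  fixes b :: "'e \<Rightarrow> ennreal"
  assumes P: "finite P" and r: "\<And>S r. (S, r) \<in> P \<Longrightarrow> 0 \<le> r \<and> ennreal r < sum b S"
  shows "\<exists>a. (\<forall>E. 0 \<le> a E \<and> (a E = 0 \<or> ennreal (a E) < b E)) \<and> (\<forall>(S, r)\<in>P. r < sum a S)"
proof -
  have "\<exists>x. (\<forall>n. x n = 0 \<or> x n < b E) \<and> x \<longlonglongrightarrow> b E" for E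
  proof (cases "b E = 0")
    case True
    then show ?thesis by (intro exI[of _ "\<lambda>_. 0"]) simp
  next
    case False
    then have "0 < b E" by (simp add: zero_less_iff_neq_zero)
    from approx_from_below_dense_linorder[OF this] show ?thesis by blast
  qed
  then obtain x where x: "\<And>E n. x E n = 0 \<or> x E n < b E" "\<And>E. x E \<longlonglongrightarrow> b E" by metis
  have "eventually (\<lambda>n. \<forall>(S, r)\<in>P. ennreal r < (\<Sum>E\<in>S. x E n)) sequentially"
  proof (rule eventually_ball_finite[OF P], safe)
    fix S r assume Sr: "(S, r) \<in> P"
    have "(\<lambda>n. \<Sum>E\<in>S. x E n) \<longlonglongrightarrow> sum b S" by (intro tendsto_sum x(2))
    then show "eventually (\<lambda>n. ennreal r < (\<Sum>E\<in>S. x E n)) sequentially"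
      by (rule order_tendstoD(1)) (use r[OF Sr] in simp)
  qed
  then obtain n where n: "\<And>S r. (S, r) \<in> P \<Longrightarrow> ennreal r < (\<Sum>E\<in>S. x E n)"
    unfolding eventually_sequentially by fast
  define a where "a E = enn2real (x E n)" for E
  have a: "ennreal (a E) = x E n" for E
    unfolding a_def by (rule ennreal_enn2real) (use x(1)[of E n] in \<open>auto simp: top.not_eq_extremum intro: less_le_trans\<close>)
  have a_nonneg: "0 \<le> a E" for E by (simp add: a_def)
  have "r < sum a S" if "(S, r) \<in> P" for S r
  proof -
    have "ennreal r < ennreal (sum a S)" using n[OF that] a a_nonneg by (simp flip: sum_ennreal)
    then show ?thesis using r[OF that] by (simp add: ennreal_less_iff)
  qed
  moreover have "a E = 0 \<or> ennreal (a E) < b E" for E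
    using x(1)[of E n] unfolding a by (auto simp: a_def)
  ultimately show ?thesis using a_nonneg by (intro exI[of _ a]) auto
qed

lemma sum_less_of_strict_masses:
  fixes b :: "'e \<Rightarrow> ennreal"
  assumes I: "finite I" and a: "\<And>E. E \<in> I \<Longrightarrow> 0 \<le> a E \<and> (a E = 0 \<or> ennreal (a E) < b E)" and ne: "sum a I \<noteq> 0"
  shows "ennreal (sum a I) < sum b I"
proof -
  obtain E where E: "E \<in> I" "a E \<noteq> 0" using ne by (meson sum.neutral)
  have le: "ennreal (a E) \<le> b E" if "E \<in> I" for E using a[OF that] by auto
  have "ennreal (sum a I) = (\<Sum>E\<in>I. ennreal (a E))" using a by (intro sum_ennreal[symmetric]) auto
  also have "\<dots> = (\<Sum>E\<in>I - {E}. ennreal (a E)) + ennreal (a E)" by (subst sum.remove[OF I E(1)]) (rule add.commute)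
  also have "\<dots> < (\<Sum>E\<in>I - {E}. ennreal (a E)) + b E"
    using a[OF E(1)] E(2) I by (simp add: ennreal_add_left_cancel_less)
  also have "\<dots> \<le> (\<Sum>E\<in>I - {E}. b E) + b E" by (intro add_right_mono sum_mono le) simp
  also have "\<dots> = sum b I" by (subst sum.remove[OF I E(1)]) (rule add.commute)
  finally show ?thesis .
qed

lemma approximate_Union_way_below:
  assumes cc: "core_compact_space X" and \<nu>: "\<nu> \<in> continuous_valuations X"
    and I: "\<And>E. E \<in> I \<Longrightarrow> openin X E" and t: "t < \<nu> (\<Union>I)"
  shows "\<exists>v. (\<forall>E\<in>I. openin X (v E) \<and> way_below_in X (v E) E) \<and> t < \<nu> (\<Union>E\<in>I. v E)"
proof -
  define A where "A = {v. \<forall>E\<in>I. openin X (v E) \<and> way_below_in X (v E) E}"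
  define D where "D = (\<lambda>v. \<Union>E\<in>I. v E) ` A"
  have opD: "openin X W" if "W \<in> D" for W using that unfolding D_def A_def by auto
  have AUn: "(\<lambda>E. v E \<union> w E) \<in> A" if "v \<in> A" "w \<in> A" for v w
  proof -
    have "way_below_in X (v E \<union> w E) E" if "E \<in> I" for E
      using way_below_Un[of X "v E" E "w E" E] \<open>v \<in> A\<close> \<open>w \<in> A\<close> that by (simp add: A_def)
    then show ?thesis using that unfolding A_def by (simp add: openin_Un)
  qed
  have "directed_family D" unfolding directed_family_def
  proof (intro conjI ballI)
    have "(\<lambda>_. {}) \<in> A" unfolding A_def by (simp add: way_below_empty)
    then show "D \<noteq> {}" unfolding D_def by blast
    fix U V assume "U \<in> D" "V \<in> D"
    then obtain u v where "u \<in> A" "v \<in> A" "U = (\<Union>E\<in>I. u E)" "V = (\<Union>E\<in>I. v E)" unfolding D_def by blast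
    then show "\<exists>W\<in>D. U \<subseteq> W \<and> V \<subseteq> W"
      unfolding D_def by (intro bexI[OF _ imageI[OF AUn[of u v]]]) auto
  qed
  moreover have "\<Union>D = \<Union>I"
  proof
    have "v E \<subseteq> E" if "v \<in> A" "E \<in> I" for v E
      using that way_below_imp_subset[of X "v E" E] I[of E] unfolding A_def by simp
    then show "\<Union>D \<subseteq> \<Union>I" unfolding D_def by blast
    show "\<Union>I \<subseteq> \<Union>D"
    proof
      fix x assume "x \<in> \<Union>I"
      then obtain E where E: "E \<in> I" "x \<in> E" by blast
      then obtain V where V: "openin X V" "way_below_in X V E" "x \<in> V"
        using directed_way_below(2)[OF cc I[OF E(1)]] by blast
      have "(\<lambda>E'. if E' = E then V else {}) \<in> A" unfolding A_def using V by (simp add: way_below_empty)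
      then have "(\<Union>E'\<in>I. if E' = E then V else {}) \<in> D" unfolding D_def by (rule imageI)
      moreover have "x \<in> (\<Union>E'\<in>I. if E' = E then V else {})" using E V(3) by auto
      ultimately show "x \<in> \<Union>D" by blast
    qed
  qed
  ultimately have "t < (SUP W\<in>D. \<nu> W)" using t continuous_valuationsD(5)[OF \<nu>, of D] opD by simp
  then obtain W where "W \<in> D" "t < \<nu> W" using less_SUP_iff by metis
  then show ?thesis unfolding D_def A_def by blast
qed

text \<open>
  Given finitely many conditions \<open>\<nu> U > r\<close>, distribute the mass of \<open>\<nu>\<close> over the closure
  \<open>L\<close> of the sets \<open>U\<close> under intersections, lower the masses a little, and shrink each \<open>E\<close> in
  \<open>L\<close> to some \<open>w E\<close> way below it such that \<open>\<nu>\<close> still gives every union of the sets \<open>w E\<close>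
  more than the sum of the corresponding masses. These finitely many inequalities define the open set \<open>N\<close>. A Scott-open filter
  between \<open>w E\<close> and \<open>E\<close> gives a capacity that lies below every member of \<open>N\<close> and still forces
  the conditions on the sets \<open>U\<close>.
\<close>

lemma valuations_above_neighbourhood:
  fixes X :: "'a topology"
  assumes cc: "core_compact_space X" and S: "openin (valuation_space X) S" "\<nu> \<in> S"
  obtains J :: "'a set set" and F a N where "finite J" "\<forall>j\<in>J. scott_open_filter X (F j)"
    "\<forall>j\<in>J. 0 \<le> a j" "openin (valuation_space X) N" "\<nu> \<in> N"
    "N \<subseteq> valuations_above X (filter_capacity a F J)" "valuations_above X (filter_capacity a F J) \<subseteq> S"
proof -
  obtain P where P: "finite P" "\<forall>(U, r)\<in>P. openin X U \<and> 0 \<le> r" "\<nu> \<in> weak_basic_set X P" "weak_basic_set X P \<subseteq> S"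
    using weak_basic_set_base[OF S] by (elim exE conjE)
  have \<nu>: "\<nu> \<in> continuous_valuations X" using P(3) by (simp add: weak_basic_set_def)
  have PD: "openin X U" "0 \<le> r" "ennreal r < \<nu> U" if "(U, r) \<in> P" for U r
    using that P(2,3) by (auto simp: weak_basic_set_def)
  define L where "L = Inter ` (Pow (fst ` P) - {{}})"
  have finL: "finite L" unfolding L_def using P(1) by simp
  have L_cases: "\<exists>T. T \<subseteq> fst ` P \<and> T \<noteq> {} \<and> E = \<Inter>T" if "E \<in> L" for E
  proof -
    from that obtain T where "E = \<Inter>T" "T \<in> Pow (fst ` P) - {{}}" unfolding L_def by (rule imageE)
    then show ?thesis by (intro exI[of _ T]) simp
  qed
  have opL: "openin X E" if EL: "E \<in> L" for E
  proof -
    obtain T where T: "T \<subseteq> fst ` P" "T \<noteq> {}" "E = \<Inter>T" using L_cases[OF EL] by (elim exE conjE)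
    have "openin X U" if "U \<in> T" for U
    proof -
      have "U \<in> fst ` P" using T(1) that by (rule subsetD)
      then obtain p where "U = fst p" "p \<in> P" by (rule imageE)
      then show ?thesis using PD(1)[of U "snd p"] by simp
    qed
    then show ?thesis unfolding T(3) using finite_subset[OF T(1)] P(1) T(2) by (intro openin_Inter) auto
  qed
  have IntL: "E \<inter> E' \<in> L" if EE': "E \<in> L" "E' \<in> L" for E E'
  proof -
    obtain T T' where T: "T \<subseteq> fst ` P" "T \<noteq> {}" "E = \<Inter>T" "T' \<subseteq> fst ` P" "E' = \<Inter>T'"
      using L_cases[OF EE'(1)] L_cases[OF EE'(2)] by (elim exE conjE)
    then have "E \<inter> E' = \<Inter>(T \<union> T')" "T \<union> T' \<in> Pow (fst ` P) - {{}}" by auto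
    then show ?thesis unfolding L_def by (rule image_eqI)
  qed
  have PL: "U \<in> L" if "(U, r) \<in> P" for U r
    unfolding L_def by (rule image_eqI[of _ _ "{U}"]) (use that in \<open>auto intro: rev_image_eqI\<close>)
  have "\<exists>b. \<forall>U. openin X U \<longrightarrow> sum b {E \<in> L. E \<subseteq> U} \<le> \<nu> (U \<inter> \<Union>L) \<and>
      ((\<forall>E\<in>L. U \<inter> E \<in> L) \<longrightarrow> sum b {E \<in> L. E \<subseteq> U} = \<nu> (U \<inter> \<Union>L))"
    by (rule valuation_masses_on_Int_closed_family[OF \<nu> finL]) (fact opL, fact IntL)
  then obtain b where b: "\<forall>U. openin X U \<longrightarrow> sum b {E \<in> L. E \<subseteq> U} \<le> \<nu> (U \<inter> \<Union>L) \<and>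
      ((\<forall>E\<in>L. U \<inter> E \<in> L) \<longrightarrow> sum b {E \<in> L. E \<subseteq> U} = \<nu> (U \<inter> \<Union>L))" by (elim exE)
  have b_le: "sum b {E \<in> L. E \<subseteq> U} \<le> \<nu> (U \<inter> \<Union>L)" if "openin X U" for U
    using b[rule_format, OF that] by simp
  have b_eq: "sum b {E \<in> L. E \<subseteq> U} = \<nu> (U \<inter> \<Union>L)" if "openin X U" "\<And>E. E \<in> L \<Longrightarrow> U \<inter> E \<in> L" for U
    using b[rule_format, OF that(1)] that(2) by simp
  have masses: "0 \<le> r \<and> ennreal r < sum b {E \<in> L. E \<subseteq> U}" if Ur: "(U, r) \<in> P" for U r
  proof -
    have "U \<inter> \<Union>L = U" using PL[OF Ur] by blast
    then have "sum b {E \<in> L. E \<subseteq> U} = \<nu> U" using b_eq[OF PD(1)[OF Ur]] IntL[OF PL[OF Ur]] by simp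
    then show ?thesis using PD[OF Ur] by simp
  qed
  have "\<exists>a. (\<forall>E. 0 \<le> a E \<and> (a E = 0 \<or> ennreal (a E) < b E)) \<and>
      (\<forall>(S, r)\<in>(\<lambda>(U, r). ({E \<in> L. E \<subseteq> U}, r)) ` P. r < sum a S)"
    by (rule approximate_masses_from_below) (use P(1) masses in auto)
  then obtain a where a0: "(\<forall>E. 0 \<le> a E \<and> (a E = 0 \<or> ennreal (a E) < b E)) \<and>
      (\<forall>(S, r)\<in>(\<lambda>(U, r). ({E \<in> L. E \<subseteq> U}, r)) ` P. r < sum a S)" by (elim exE)
  have a: "0 \<le> a E" "a E = 0 \<or> ennreal (a E) < b E" for E using conjunct1[OF a0] by simp_all
  have aP: "r < sum a {E \<in> L. E \<subseteq> U}" if "(U, r) \<in> P" for U r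
    using bspec[OF conjunct2[OF a0] imageI[OF that]] by simp
  have less: "ennreal (sum a I) < \<nu> (\<Union>I)" if I: "I \<subseteq> L" "sum a I \<noteq> 0" for I
  proof -
    have opI: "openin X (\<Union>I)" using I(1) opL by blast
    have "ennreal (sum a I) < sum b I"
      by (rule sum_less_of_strict_masses) (use I a finL finite_subset in auto)
    also have "\<dots> \<le> sum b {E \<in> L. E \<subseteq> \<Union>I}" by (rule sum_mono2) (use finL I(1) in auto)
    also have "\<dots> \<le> \<nu> (\<Union>I \<inter> \<Union>L)" by (rule b_le[OF opI])
    also have "\<Union>I \<inter> \<Union>L = \<Union>I" using I(1) by blast
    finally show ?thesis .
  qed
  have "\<exists>v. I \<subseteq> L \<longrightarrow> sum a I \<noteq> 0 \<longrightarrow> (\<forall>E\<in>I. openin X (v E) \<and> way_below_in X (v E) E) \<and>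
      ennreal (sum a I) < \<nu> (\<Union>E\<in>I. v E)" for I
  proof (cases "I \<subseteq> L \<and> sum a I \<noteq> 0")
    case True
    have "openin X E" if "E \<in> I" for E using True that opL by blast
    from approximate_Union_way_below[OF cc \<nu> this less] True show ?thesis by simp
  qed auto
  then obtain v where v0: "\<And>I. I \<subseteq> L \<longrightarrow> sum a I \<noteq> 0 \<longrightarrow>
      (\<forall>E\<in>I. openin X (v I E) \<and> way_below_in X (v I E) E) \<and> ennreal (sum a I) < \<nu> (\<Union>E\<in>I. v I E)"
    by metis
  have v: "openin X (v I E) \<and> way_below_in X (v I E) E" if "I \<subseteq> L" "sum a I \<noteq> 0" "E \<in> I" for I E
    using v0[of I] that by simp
  have v_less: "ennreal (sum a I) < \<nu> (\<Union>E\<in>I. v I E)" if "I \<subseteq> L" "sum a I \<noteq> 0" for I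
    using v0[of I] that by simp
  \<comment> \<open>Index sets of total mass \<open>0\<close> impose no condition, and the strict inequality may fail for them.\<close>
  define K where "K = {I. I \<subseteq> L \<and> sum a I \<noteq> 0}"
  have finK: "finite K" unfolding K_def by (rule finite_subset[of _ "Pow L"]) (use finL in auto)
  define w where "w E = (\<Union>I\<in>{I\<in>K. E \<in> I}. v I E)" for E
  have w_open: "openin X (w E)" for E unfolding w_def using v by (auto simp: K_def)
  have w_below: "way_below_in X (w E) E" for E
    unfolding w_def
  proof (rule way_below_UN)
    show "finite {I \<in> K. E \<in> I}" using finK by simp
    show "way_below_in X (v I E) E" if "I \<in> {I \<in> K. E \<in> I}" for I using that v by (simp add: K_def)
  qed
  have w_less: "ennreal (sum a I) < \<nu> (\<Union>E\<in>I. w E)" if I: "I \<in> K" for I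
  proof -
    have "ennreal (sum a I) < \<nu> (\<Union>E\<in>I. v I E)" using v_less I by (simp add: K_def)
    also have "\<dots> \<le> \<nu> (\<Union>E\<in>I. w E)"
    proof (rule continuous_valuationsD(4)[OF \<nu>])
      show "openin X (\<Union>E\<in>I. v I E)" using v I by (auto simp: K_def)
      show "openin X (\<Union>E\<in>I. w E)" using w_open by blast
      show "(\<Union>E\<in>I. v I E) \<subseteq> (\<Union>E\<in>I. w E)" using I unfolding w_def by blast
    qed
    finally show ?thesis .
  qed
  have "\<exists>F. scott_open_filter X F \<and> E \<in> F \<and> (\<forall>W\<in>F. w E \<subseteq> W)" if "E \<in> L" for E
    by (rule scott_open_filter_between[OF cc opL[OF that] w_below])
  then obtain F where F: "\<And>E. E \<in> L \<Longrightarrow> scott_open_filter X (F E)" "\<And>E. E \<in> L \<Longrightarrow> E \<in> F E"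
      "\<And>E W. E \<in> L \<Longrightarrow> W \<in> F E \<Longrightarrow> w E \<subseteq> W" by metis
  define R where "R = (\<lambda>I. (\<Union>E\<in>I. w E, sum a I)) ` K"
  show thesis
  proof (rule that[of L F a "weak_basic_set X R"])
    show "openin (valuation_space X) (weak_basic_set X R)"
    proof (rule openin_weak_basic_set)
      show "finite R" unfolding R_def using finK by simp
      fix U r assume "(U, r) \<in> R"
      then obtain I where "U = (\<Union>E\<in>I. w E)" "r = sum a I" unfolding R_def by blast
      then show "openin X U \<and> 0 \<le> r" using w_open a(1) by (simp add: sum_nonneg openin_clauses(3))
    qed
    show "\<nu> \<in> weak_basic_set X R" unfolding weak_basic_set_def R_def using \<nu> w_less by auto
    show "weak_basic_set X R \<subseteq> valuations_above X (filter_capacity a F L)"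
    proof
      fix \<mu> assume \<mu>: "\<mu> \<in> weak_basic_set X R"
      then have \<mu>CV: "\<mu> \<in> continuous_valuations X" by (simp add: weak_basic_set_def)
      have "ennreal (filter_capacity a F L U) \<le> \<mu> U" if U: "openin X U" for U
      proof -
        define I where "I = {E \<in> L. U \<in> F E}"
        have c: "filter_capacity a F L U = sum a I"
          unfolding filter_capacity_def I_def by (rule sum.inter_filter[OF finL, symmetric])
        show ?thesis
        proof (cases "sum a I = 0")
          case True
          then show ?thesis by (simp add: c)
        next
          case False
          then have "I \<in> K" by (auto simp: K_def I_def)
          then have "ennreal (sum a I) < \<mu> (\<Union>E\<in>I. w E)" using \<mu> unfolding weak_basic_set_def R_def by auto
          also have "\<dots> \<le> \<mu> U"
          proof (rule continuous_valuationsD(4)[OF \<mu>CV _ U])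
            show "openin X (\<Union>E\<in>I. w E)" using w_open by blast
            show "(\<Union>E\<in>I. w E) \<subseteq> U" using F(3) unfolding I_def by blast
          qed
          finally show ?thesis by (simp add: c)
        qed
      qed
      then show "\<mu> \<in> valuations_above X (filter_capacity a F L)" using \<mu>CV by (simp add: valuations_above_def)
    qed
    have "valuations_above X (filter_capacity a F L) \<subseteq> weak_basic_set X P"
    proof
      fix \<mu> assume \<mu>: "\<mu> \<in> valuations_above X (filter_capacity a F L)"
      have "ennreal r < \<mu> U" if Ur: "(U, r) \<in> P" for U r
      proof -
        have U: "openin X U" by (rule PD(1)[OF Ur])
        have "sum a {E \<in> L. E \<subseteq> U} = (\<Sum>E\<in>L. if E \<subseteq> U then a E else 0)" by (rule sum.inter_filter[OF finL])
        also have "\<dots> \<le> filter_capacity a F L U" unfolding filter_capacity_def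
        proof (rule sum_mono)
          fix E assume E: "E \<in> L"
          show "(if E \<subseteq> U then a E else 0) \<le> (if U \<in> F E then a E else 0)"
            using scott_open_filterD(3)[OF F(1)[OF E] F(2)[OF E] U] a(1)[of E] by auto
        qed
        finally have "r < filter_capacity a F L U" using aP[OF Ur] by simp
        then have "ennreal r < ennreal (filter_capacity a F L U)" using PD(2)[OF Ur] by (simp add: ennreal_lessI)
        also have "\<dots> \<le> \<mu> U" using \<mu> U by (simp add: valuations_above_def)
        finally show ?thesis .
      qed
      then show "\<mu> \<in> weak_basic_set X P" using \<mu> by (auto simp: weak_basic_set_def valuations_above_def)
    qed
    then show "valuations_above X (filter_capacity a F L) \<subseteq> S" using P(4) by blast
  qed (use finL F(1) a(1) in auto)
qed

section \<open>Sobriety\<close>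

lemma ennreal_add_le_of_approximants:
  fixes a b z :: ennreal
  assumes "\<And>x y. x < a \<Longrightarrow> y < b \<Longrightarrow> x + y \<le> z" "a \<le> z" "b \<le> z"
  shows "a + b \<le> z"
proof (cases "a = 0 \<or> b = 0")
  case True
  then show ?thesis using assms(2,3) by auto
next
  case False
  then have "0 < a" "0 < b" by (auto simp: zero_less_iff_neq_zero)
  from approx_from_below_dense_linorder[OF this(1)] approx_from_below_dense_linorder[OF this(2)]
  obtain x y where x: "\<And>n. x n < a" "x \<longlonglongrightarrow> a" and y: "\<And>n. y n < b" "y \<longlonglongrightarrow> b" by (elim exE conjE) blast
  have "(\<lambda>n. x n + y n) \<longlonglongrightarrow> a + b" by (intro tendsto_add x y)
  then show ?thesis by (rule LIMSEQ_le_const2) (use assms(1)[OF x(1) y(1)] in blast)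
qed

definition valuation_sup :: "'a topology \<Rightarrow> ('a set \<Rightarrow> ennreal) set \<Rightarrow> 'a set \<Rightarrow> ennreal" where
  "valuation_sup X C = (\<lambda>U\<in>{U. openin X U}. SUP \<mu>\<in>C. \<mu> U)"

lemma valuation_sup_upper: "\<mu> \<in> C \<Longrightarrow> openin X U \<Longrightarrow> \<mu> U \<le> valuation_sup X C U"
  by (simp add: valuation_sup_def) (rule SUP_upper)

lemma less_valuation_sup: "openin X U \<Longrightarrow> x < valuation_sup X C U \<longleftrightarrow> (\<exists>\<mu>\<in>C. x < \<mu> U)"
  by (simp add: valuation_sup_def less_SUP_iff)

text \<open>
  Scott continuity holds because suprema commute with suprema. Modularity needs that lower bounds on the values at
  two open sets, each attained in \<open>C\<close>, are attained by a common member; this is what irreducibility of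
  \<open>C\<close> provides.
\<close>

lemma valuation_sup_continuous:
  assumes C: "C \<subseteq> continuous_valuations X" "C \<noteq> {}"
    and irr: "\<And>U V r s. \<lbrakk>openin X U; openin X V; 0 \<le> r; 0 \<le> s; \<exists>\<mu>\<in>C. ennreal r < \<mu> U; \<exists>\<mu>\<in>C. ennreal s < \<mu> V\<rbrakk>
      \<Longrightarrow> \<exists>\<mu>\<in>C. ennreal r < \<mu> U \<and> ennreal s < \<mu> V"
  shows "valuation_sup X C \<in> continuous_valuations X"
proof (rule continuous_valuationsI)
  let ?\<sigma> = "valuation_sup X C"
  have CV: "\<mu> \<in> continuous_valuations X" if "\<mu> \<in> C" for \<mu> using C(1) that by blast
  show "?\<sigma> \<in> extensional {U. openin X U}" by (simp add: valuation_sup_def)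
  show "?\<sigma> {} = 0"
  proof -
    have "(SUP \<mu>\<in>C. \<mu> {}) = (SUP \<mu>\<in>C. 0)" by (rule SUP_cong) (use continuous_valuationsD(2)[OF CV] in auto)
    then show ?thesis using C(2) by (simp add: valuation_sup_def)
  qed
  show "?\<sigma> U \<le> ?\<sigma> V" if "openin X U" "openin X V" "U \<subseteq> V" for U V
  proof -
    have "(SUP \<mu>\<in>C. \<mu> U) \<le> (SUP \<mu>\<in>C. \<mu> V)"
      by (rule SUP_mono) (use continuous_valuationsD(4)[OF CV that] in blast)
    then show ?thesis using that by (simp add: valuation_sup_def)
  qed
  have half: "?\<sigma> A + ?\<sigma> B \<le> ?\<sigma> U + ?\<sigma> V"
    if op: "openin X A" "openin X B" "openin X U" "openin X V"
      and le: "\<And>\<mu>. \<mu> \<in> C \<Longrightarrow> \<mu> A + \<mu> B \<le> \<mu> U + \<mu> V" for A B U V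
  proof -
    have le': "\<mu> A + \<mu> B \<le> ?\<sigma> U + ?\<sigma> V" if "\<mu> \<in> C" for \<mu>
      using le[OF that] add_mono[OF valuation_sup_upper[OF that op(3)] valuation_sup_upper[OF that op(4)]]
      by (rule order_trans)
    have "x + y \<le> ?\<sigma> U + ?\<sigma> V" if x: "x < ?\<sigma> A" and y: "y < ?\<sigma> B" for x y
    proof -
      obtain r where r: "x = ennreal r" "0 \<le> r" using x by (cases x) auto
      obtain s where s: "y = ennreal s" "0 \<le> s" using y by (cases y) auto
      have "\<exists>\<mu>\<in>C. ennreal r < \<mu> A" "\<exists>\<mu>\<in>C. ennreal s < \<mu> B"
        using x y less_valuation_sup[OF op(1)] less_valuation_sup[OF op(2)] r s by simp_all
      then obtain \<mu> where \<mu>: "\<mu> \<in> C" "ennreal r < \<mu> A" "ennreal s < \<mu> B"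
        using irr[OF op(1,2) r(2) s(2)] by blast
      have "x + y \<le> \<mu> A + \<mu> B" using \<mu> r s by (intro add_mono) auto
      then show ?thesis using le'[OF \<mu>(1)] by (rule order_trans)
    qed
    moreover have "?\<sigma> A \<le> ?\<sigma> U + ?\<sigma> V" "?\<sigma> B \<le> ?\<sigma> U + ?\<sigma> V"
    proof -
      have "\<mu> A \<le> \<mu> A + \<mu> B" "\<mu> B \<le> \<mu> A + \<mu> B" for \<mu> :: "'a set \<Rightarrow> ennreal" by simp_all
      then have "\<mu> A \<le> ?\<sigma> U + ?\<sigma> V" "\<mu> B \<le> ?\<sigma> U + ?\<sigma> V" if "\<mu> \<in> C" for \<mu>
        using le'[OF that] order_trans by blast+
      then show "?\<sigma> A \<le> ?\<sigma> U + ?\<sigma> V" "?\<sigma> B \<le> ?\<sigma> U + ?\<sigma> V"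
        using op(1,2) by (simp_all add: valuation_sup_def[of X C] SUP_le_iff del: restrict_apply) (auto intro!: SUP_least)
    qed
    ultimately show ?thesis by (rule ennreal_add_le_of_approximants)
  qed
  show "?\<sigma> U + ?\<sigma> V = ?\<sigma> (U \<union> V) + ?\<sigma> (U \<inter> V)" if UV: "openin X U" "openin X V" for U V
  proof (rule antisym)
    have op: "openin X (U \<union> V)" "openin X (U \<inter> V)" using UV by auto
    show "?\<sigma> U + ?\<sigma> V \<le> ?\<sigma> (U \<union> V) + ?\<sigma> (U \<inter> V)"
      by (rule half[OF UV op]) (simp add: continuous_valuationsD(3)[OF CV UV])
    show "?\<sigma> (U \<union> V) + ?\<sigma> (U \<inter> V) \<le> ?\<sigma> U + ?\<sigma> V"
      by (rule half[OF op UV]) (simp add: continuous_valuationsD(3)[OF CV UV])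
  qed
  show "?\<sigma> (\<Union>D) = (SUP W\<in>D. ?\<sigma> W)" if D: "\<And>W. W \<in> D \<Longrightarrow> openin X W" "directed_family D" for D
  proof -
    have "openin X (\<Union>D)" using D(1) by (auto intro: openin_Union)
    then have "?\<sigma> (\<Union>D) = (SUP \<mu>\<in>C. \<mu> (\<Union>D))" by (simp add: valuation_sup_def)
    also have "\<dots> = (SUP \<mu>\<in>C. SUP W\<in>D. \<mu> W)"
      by (rule SUP_cong[OF refl]) (rule continuous_valuationsD(5)[OF CV D])
    also have "\<dots> = (SUP W\<in>D. SUP \<mu>\<in>C. \<mu> W)" by (rule SUP_commute)
    also have "\<dots> = (SUP W\<in>D. ?\<sigma> W)" by (rule SUP_cong[OF refl]) (simp add: valuation_sup_def D(1))
    finally show ?thesis .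
  qed
qed

lemma t0_space_valuation_space: "t0_space (valuation_space X)"
  unfolding t0_space_def topspace_valuation_space
proof (intro ballI impI)
  have *: "\<exists>S. openin (valuation_space X) S \<and> \<mu> \<notin> S \<and> \<nu> \<in> S"
    if \<mu>\<nu>: "\<mu> \<in> continuous_valuations X" "\<nu> \<in> continuous_valuations X" "openin X U" "\<mu> U < \<nu> U" for \<mu> \<nu> U
  proof -
    obtain r where r: "\<mu> U = ennreal r" "0 \<le> r" using \<mu>\<nu>(4) by (cases "\<mu> U") auto
    have "openin (valuation_space X) (weak_basic_set X {(U, r)})"
      by (rule openin_weak_basic_set) (use \<mu>\<nu>(3) r in auto)
    then show ?thesis
      using \<mu>\<nu> r by (intro exI[of _ "weak_basic_set X {(U, r)}"]) (simp add: weak_basic_set_def)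
  qed
  fix \<mu> \<nu> assume \<mu>\<nu>: "\<mu> \<in> continuous_valuations X" "\<nu> \<in> continuous_valuations X" "\<mu> \<noteq> \<nu>"
  obtain U where U: "openin X U" "\<mu> U \<noteq> \<nu> U"
    using extensionalityI[OF continuous_valuationsD(1)[OF \<mu>\<nu>(1)] continuous_valuationsD(1)[OF \<mu>\<nu>(2)]] \<mu>\<nu>(3) by blast
  then consider "\<mu> U < \<nu> U" | "\<nu> U < \<mu> U" by fastforce
  then show "\<exists>S. openin (valuation_space X) S \<and> (\<mu> \<notin> S) = (\<nu> \<in> S)"
    using *[OF \<mu>\<nu>(1,2) U(1)] *[OF \<mu>\<nu>(2,1) U(1)] by cases blast+
qed

lemma irreducible_closedin_meets_Int:
  assumes C: "irreducible_closedin Y C" and A: "openin Y A" "C \<inter> A \<noteq> {}" and B: "openin Y B" "C \<inter> B \<noteq> {}"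
  shows "C \<inter> (A \<inter> B) \<noteq> {}"
proof
  assume "C \<inter> (A \<inter> B) = {}"
  moreover have "C \<subseteq> topspace Y" using C closedin_subset unfolding irreducible_closedin_def by blast
  ultimately have "C \<subseteq> (topspace Y - A) \<union> (topspace Y - B)" by blast
  moreover have "closedin Y (topspace Y - A)" "closedin Y (topspace Y - B)" using A(1) B(1) by auto
  ultimately have "C \<subseteq> topspace Y - A \<or> C \<subseteq> topspace Y - B" using C unfolding irreducible_closedin_def by simp
  then show False using A(2) B(2) by blast
qed

text \<open>
  The generic point of an irreducible closed set \<open>C\<close> is its pointwise supremum \<open>\<sigma>\<close>. By
  irreducibility every basic neighbourhood of \<open>\<sigma>\<close> meets \<open>C\<close>, so \<open>\<sigma>\<close> is in \<open>C\<close>;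
  and it is above every member of \<open>C\<close>, hence in all their neighbourhoods. The hypothesis ensures that this
  supremum does not leave the subspace.
\<close>

lemma sober_valuation_subspace:
  assumes T: "\<And>C. \<lbrakk>C \<noteq> {}; C \<subseteq> T; valuation_sup X C \<in> continuous_valuations X\<rbrakk> \<Longrightarrow> valuation_sup X C \<in> T"
  shows "sober_space (subtopology (valuation_space X) T)"
  unfolding sober_space_def
proof (intro conjI allI impI)
  let ?Y = "subtopology (valuation_space X) T"
  show "t0_space ?Y" by (rule t0_space_subtopology[OF t0_space_valuation_space])
  fix C assume irr: "irreducible_closedin ?Y C"
  then have Cclosed: "closedin ?Y C" and Cne: "C \<noteq> {}" unfolding irreducible_closedin_def by simp_all
  have CT: "C \<subseteq> T" "C \<subseteq> continuous_valuations X"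
    using closedin_subset[OF Cclosed] by (simp_all add: topspace_valuation_space)
  have opY: "openin ?Y (T \<inter> weak_basic_set X P)" if "finite P" "\<And>U r. (U, r) \<in> P \<Longrightarrow> openin X U \<and> 0 \<le> r" for P
    using openin_subtopology_Int2[OF openin_weak_basic_set[OF that]] .
  define \<sigma> where "\<sigma> = valuation_sup X C"
  have meets: "C \<inter> (T \<inter> weak_basic_set X P) \<noteq> {}"
    if "finite P" "\<forall>(U, r)\<in>P. openin X U \<and> 0 \<le> r \<and> (\<exists>\<mu>\<in>C. ennreal r < \<mu> U)" for P
    using that
  proof (induction P)
    case empty
    then show ?case using Cne CT by (auto simp: weak_basic_set_def)
  next
    case (insert p P)
    obtain U r where p: "p = (U, r)" by (cases p)
    have Ur: "openin X U" "0 \<le> r" "\<exists>\<mu>\<in>C. ennreal r < \<mu> U" and P: "\<forall>(U, r)\<in>P. openin X U \<and> 0 \<le> r \<and> (\<exists>\<mu>\<in>C. ennreal r < \<mu> U)"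
      using insert.prems by (simp_all add: p)
    have IH: "C \<inter> (T \<inter> weak_basic_set X P) \<noteq> {}" by (rule insert.IH[OF P])
    have "C \<inter> (T \<inter> weak_basic_set X {(U, r)}) \<noteq> {}" using Ur(3) CT by (auto simp: weak_basic_set_def)
    moreover have "openin ?Y (T \<inter> weak_basic_set X {(U, r)})" by (rule opY) (use Ur in auto)
    moreover have "openin ?Y (T \<inter> weak_basic_set X P)" by (rule opY) (use insert.hyps P in auto)
    ultimately have "C \<inter> ((T \<inter> weak_basic_set X {(U, r)}) \<inter> (T \<inter> weak_basic_set X P)) \<noteq> {}"
      using irreducible_closedin_meets_Int[OF irr] IH by simp
    moreover have "(T \<inter> weak_basic_set X {(U, r)}) \<inter> (T \<inter> weak_basic_set X P) = T \<inter> weak_basic_set X (insert p P)"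
      by (auto simp: weak_basic_set_def p)
    ultimately show ?case by simp
  qed
  have \<sigma>CV: "\<sigma> \<in> continuous_valuations X" unfolding \<sigma>_def
  proof (rule valuation_sup_continuous[OF CT(2) Cne])
    fix U V r s assume *: "openin X U" "openin X V" "0 \<le> r" "0 \<le> s" "\<exists>\<mu>\<in>C. ennreal r < \<mu> U" "\<exists>\<mu>\<in>C. ennreal s < \<mu> V"
    have "C \<inter> (T \<inter> weak_basic_set X {(U, r), (V, s)}) \<noteq> {}" by (rule meets) (use * in auto)
    then show "\<exists>\<mu>\<in>C. ennreal r < \<mu> U \<and> ennreal s < \<mu> V" by (auto simp: weak_basic_set_def)
  qed
  have \<sigma>T: "\<sigma> \<in> T" using T[OF Cne CT(1)] \<sigma>CV by (simp add: \<sigma>_def)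
  have "\<sigma> \<in> C"
  proof (rule ccontr)
    assume "\<sigma> \<notin> C"
    have "openin ?Y (topspace ?Y - C)" using Cclosed by blast
    then obtain S where S: "openin (valuation_space X) S" "topspace ?Y - C = S \<inter> T"
      unfolding openin_subtopology by blast
    have "\<sigma> \<in> S" using S(2) \<sigma>T \<sigma>CV \<open>\<sigma> \<notin> C\<close> by (auto simp: topspace_valuation_space)
    obtain P where P: "finite P" "\<forall>(U, r)\<in>P. openin X U \<and> 0 \<le> r" "\<sigma> \<in> weak_basic_set X P" "weak_basic_set X P \<subseteq> S"
      using weak_basic_set_base[OF S(1) \<open>\<sigma> \<in> S\<close>] by (elim exE conjE)
    have "C \<inter> (T \<inter> weak_basic_set X P) \<noteq> {}"
    proof (rule meets[OF P(1)], safe)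
      fix U r assume Ur: "(U, r) \<in> P"
      show "openin X U" "0 \<le> r" using P(2) Ur by auto
      then show "\<exists>\<mu>\<in>C. ennreal r < \<mu> U"
        using P(3) Ur by (auto simp: weak_basic_set_def \<sigma>_def less_valuation_sup)
    qed
    then show False using P(4) S(2) by blast
  qed
  have "C = ?Y closure_of {\<sigma>}"
  proof
    show "?Y closure_of {\<sigma>} \<subseteq> C" by (rule closure_of_minimal) (use \<open>\<sigma> \<in> C\<close> Cclosed in auto)
    show "C \<subseteq> ?Y closure_of {\<sigma>}"
    proof
      fix \<mu> assume \<mu>: "\<mu> \<in> C"
      have "\<sigma> \<in> S'" if S': "\<mu> \<in> S'" "openin ?Y S'" for S'
      proof -
        obtain S where S: "openin (valuation_space X) S" "S' = S \<inter> T" using S'(2) unfolding openin_subtopology by blast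
        have "\<mu> \<in> S" using S(2) S'(1) by blast
        obtain P where P: "\<forall>(U, r)\<in>P. openin X U \<and> 0 \<le> r" "\<mu> \<in> weak_basic_set X P" "weak_basic_set X P \<subseteq> S"
          using weak_basic_set_base[OF S(1) \<open>\<mu> \<in> S\<close>] by (elim exE conjE)
        have "ennreal r < \<sigma> U" if "(U, r) \<in> P" for U r
        proof -
          have "openin X U" "ennreal r < \<mu> U" using P(1,2) that by (auto simp: weak_basic_set_def)
          then show ?thesis unfolding \<sigma>_def using valuation_sup_upper[OF \<mu>] less_le_trans by blast
        qed
        then have "\<sigma> \<in> weak_basic_set X P" using \<sigma>CV by (auto simp: weak_basic_set_def)
        then show ?thesis using P(3) S(2) \<sigma>T by blast
      qed
      moreover have "\<mu> \<in> topspace ?Y" using \<mu> CT by (auto simp: topspace_valuation_space)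
      ultimately show "\<mu> \<in> ?Y closure_of {\<sigma>}" unfolding in_closure_of by simp
    qed
  qed
  then show "\<exists>x\<in>topspace ?Y. C = ?Y closure_of {x}"
    using \<sigma>T \<sigma>CV by (intro bexI[of _ \<sigma>]) (simp_all add: topspace_valuation_space)
qed

section \<open>Local compactness of the three spaces\<close>

lemma directed_family_finite_upper_bound:
  assumes D: "directed_family D" and F: "finite F" "F \<subseteq> D"
  shows "\<exists>W\<in>D. \<Union>F \<subseteq> W"
  using F
proof (induction F)
  case empty
  then show ?case using D unfolding directed_family_def by auto
next
  case (insert V F)
  then obtain W where "W \<in> D" "\<Union>F \<subseteq> W" by auto
  moreover obtain W' where "W' \<in> D" "V \<subseteq> W'" "W \<subseteq> W'"
    using D insert.prems \<open>W \<in> D\<close> unfolding directed_family_def by (meson insert_subset)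
  ultimately show ?case by (intro bexI[of _ W']) auto
qed

lemma scott_open_filter_topspace:
  assumes "compact_space X"
  shows "scott_open_filter X {topspace X}"
proof -
  have "\<exists>W\<in>D. W = topspace X" if D: "\<forall>W\<in>D. openin X W" "directed_family D" "\<Union>D = topspace X" for D
  proof -
    have "\<exists>F. finite F \<and> F \<subseteq> D \<and> topspace X \<subseteq> \<Union>F"
      using assms[unfolded compact_space_def compactin_def, THEN conjunct2, rule_format, of D] D(1,3) by simp
    then obtain F where F: "finite F" "F \<subseteq> D" "topspace X \<subseteq> \<Union>F" by (elim exE conjE)
    obtain W where "W \<in> D" "\<Union>F \<subseteq> W" using directed_family_finite_upper_bound[OF D(2) F(1,2)] by (rule bexE)
    moreover have "W \<subseteq> topspace X" using D(1) \<open>W \<in> D\<close> by (intro openin_subset) simp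
    ultimately have "W = topspace X" using F(3) by (intro equalityI) simp_all
    with \<open>W \<in> D\<close> show ?thesis by blast
  qed
  moreover have "V = topspace X" if "openin X V" "topspace X \<subseteq> V" for V
    using openin_subset[OF that(1)] that(2) by (rule equalityI)
  ultimately show ?thesis unfolding scott_open_filter_def by simp
qed

lemma closedin_subprobability: "closedin (valuation_space X) {\<nu> \<in> continuous_valuations X. \<nu> (topspace X) \<le> 1}"
proof -
  have "openin (valuation_space X) (weak_basic_set X {(topspace X, 1)})" by (rule openin_weak_basic_set) auto
  moreover have "continuous_valuations X - {\<nu> \<in> continuous_valuations X. \<nu> (topspace X) \<le> 1} = weak_basic_set X {(topspace X, 1)}"
    by (auto simp: weak_basic_set_def)
  ultimately show ?thesis unfolding closedin_def topspace_valuation_space by auto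
qed

lemma strongly_locally_compact_valuation_space:
  assumes cc: "core_compact_space X"
  shows "strongly_locally_compact_space (valuation_space X)"
  unfolding strongly_locally_compact_space_def neighbourhood_base_of
proof (intro allI impI, elim conjE)
  fix S \<nu> assume S: "openin (valuation_space X) S" "\<nu> \<in> S"
  obtain J :: "'a set set" and F a N where J: "finite J" "\<forall>j\<in>J. scott_open_filter X (F j)"
    "\<forall>j\<in>J. 0 \<le> a j" "openin (valuation_space X) N" "\<nu> \<in> N"
    "N \<subseteq> valuations_above X (filter_capacity a F J)" "valuations_above X (filter_capacity a F J) \<subseteq> S"
    by (rule valuations_above_neighbourhood[OF cc S]) (rule that)
  have "compactin (valuation_space X) (valuations_above X (filter_capacity a F J))"
    by (rule compactin_valuations_above_filter_capacity[OF cc J(1)]) (use J(2,3) in auto)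
  then show "\<exists>U V. openin (valuation_space X) U \<and> compactin (valuation_space X) V \<and> \<nu> \<in> U \<and> U \<subseteq> V \<and> V \<subseteq> S"
    using J(4-7) by (intro exI conjI)
qed

lemma strongly_locally_compact_subprobability_valuation_space:
  assumes cc: "core_compact_space X"
  shows "strongly_locally_compact_space (subprobability_valuation_space X)"
  unfolding strongly_locally_compact_space_def neighbourhood_base_of subprobability_valuation_space_def
proof (intro allI impI, elim conjE)
  let ?T = "{\<nu>. \<nu> (topspace X) \<le> 1}"
  fix S' \<nu> assume "openin (subtopology (valuation_space X) ?T) S'" "\<nu> \<in> S'"
  then obtain S where S: "openin (valuation_space X) S" "S' = S \<inter> ?T" unfolding openin_subtopology by blast
  have \<nu>: "\<nu> \<in> S" "\<nu> \<in> ?T" using \<open>\<nu> \<in> S'\<close> S(2) by auto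
  obtain J :: "'a set set" and F a N where J: "finite J" "\<forall>j\<in>J. scott_open_filter X (F j)"
    "\<forall>j\<in>J. 0 \<le> a j" "openin (valuation_space X) N" "\<nu> \<in> N"
    "N \<subseteq> valuations_above X (filter_capacity a F J)" "valuations_above X (filter_capacity a F J) \<subseteq> S"
    by (rule valuations_above_neighbourhood[OF cc S(1) \<nu>(1)]) (rule that)
  let ?Q = "valuations_above X (filter_capacity a F J)"
  have "compactin (valuation_space X) ?Q"
    by (rule compactin_valuations_above_filter_capacity[OF cc J(1)]) (use J(2,3) in auto)
  moreover have "?Q \<inter> ?T = {\<nu> \<in> continuous_valuations X. \<nu> (topspace X) \<le> 1} \<inter> ?Q"
    by (auto simp: valuations_above_def)
  ultimately have "compactin (valuation_space X) (?Q \<inter> ?T)"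
    using closed_Int_compactin[OF closedin_subprobability] by simp
  then have "compactin (subtopology (valuation_space X) ?T) (?Q \<inter> ?T)" by (simp add: compactin_subtopology)
  moreover have "openin (subtopology (valuation_space X) ?T) (N \<inter> ?T)" using J(4) by (rule openin_subtopology_Int)
  moreover have "\<nu> \<in> N \<inter> ?T" "N \<inter> ?T \<subseteq> ?Q \<inter> ?T" "?Q \<inter> ?T \<subseteq> S'" using J(5-7) \<nu> S(2) by auto
  ultimately show "\<exists>U V. openin (subtopology (valuation_space X) ?T) U \<and>
      compactin (subtopology (valuation_space X) ?T) V \<and> \<nu> \<in> U \<and> U \<subseteq> V \<and> V \<subseteq> S'" by (intro exI conjI)
qed

text \<open>
  Here the neighbourhood has to enforce total mass at least \<open>1\<close>, which is not a closed condition. Compactness of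
  \<open>X\<close> makes \<open>{topspace X}\<close> a Scott-open filter, so the mass missing from the capacity can be added as
  one more term carried by that filter; the bound \<open>1\<close> from above is a closed condition.
\<close>

lemma strongly_locally_compact_probability_valuation_space:
  assumes cc: "core_compact_space X" and comp: "compact_space X"
  shows "strongly_locally_compact_space (probability_valuation_space X)"
  unfolding strongly_locally_compact_space_def neighbourhood_base_of probability_valuation_space_def
proof (intro allI impI, elim conjE)
  let ?T = "{\<nu>. \<nu> (topspace X) = 1}"
  fix S' \<nu> assume "openin (subtopology (valuation_space X) ?T) S'" "\<nu> \<in> S'"
  then obtain S where S: "openin (valuation_space X) S" "S' = S \<inter> ?T" unfolding openin_subtopology by blast
  have \<nu>: "\<nu> \<in> S" "\<nu> \<in> ?T" using \<open>\<nu> \<in> S'\<close> S(2) by auto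
  obtain J :: "'a set set" and F a N where J: "finite J" "\<forall>j\<in>J. scott_open_filter X (F j)"
    "\<forall>j\<in>J. 0 \<le> a j" "openin (valuation_space X) N" "\<nu> \<in> N"
    "N \<subseteq> valuations_above X (filter_capacity a F J)" "valuations_above X (filter_capacity a F J) \<subseteq> S"
    by (rule valuations_above_neighbourhood[OF cc S(1) \<nu>(1)]) (rule that)
  let ?c = "filter_capacity a F J"
  have c_top: "?c (topspace X) = sum a J"
    by (rule filter_capacity_eq_sum) (use J(2) scott_open_filterD(2) in blast)
  have "ennreal (?c (topspace X)) \<le> \<nu> (topspace X)" using J(5,6) by (auto simp: valuations_above_def)
  then have sum_le: "sum a J \<le> 1" using \<nu>(2) by (simp add: c_top)
  \<comment> \<open>The additional index \<open>None\<close> carries the missing mass.\<close>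
  define b where "b = case_option (1 - sum a J) a"
  define G where "G = case_option {topspace X} F"
  let ?J = "insert None (Some ` J)"
  let ?c' = "filter_capacity b G ?J"
  have c': "?c' U = ?c U + (if U = topspace X then 1 - sum a J else 0)" for U
    using J(1) by (simp add: filter_capacity_def b_def G_def sum.reindex cong: if_cong)
  let ?Q = "valuations_above X ?c'"
  let ?K = "{\<nu> \<in> continuous_valuations X. \<nu> (topspace X) \<le> 1} \<inter> ?Q"
  have "compactin (valuation_space X) ?Q"
  proof (rule compactin_valuations_above_filter_capacity[OF cc])
    show "scott_open_filter X (G j)" if "j \<in> ?J" for j
      using that J(2) scott_open_filter_topspace[OF comp] by (auto simp: G_def)
    show "0 \<le> b j" if "j \<in> ?J" for j using that J(3) sum_le by (auto simp: b_def)
  qed (use J(1) in simp)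
  then have "compactin (valuation_space X) ?K" by (rule closed_Int_compactin[OF closedin_subprobability])
  moreover have KT: "?K \<subseteq> ?T"
  proof
    fix \<mu> assume \<mu>: "\<mu> \<in> ?K"
    then have "ennreal (?c' (topspace X)) \<le> \<mu> (topspace X)" by (simp add: valuations_above_def)
    then show "\<mu> \<in> ?T" using \<mu> by (simp add: c' c_top)
  qed
  ultimately have "compactin (subtopology (valuation_space X) ?T) ?K" by (simp add: compactin_subtopology)
  moreover have "openin (subtopology (valuation_space X) ?T) (N \<inter> ?T)" using J(4) by (rule openin_subtopology_Int)
  moreover have "\<nu> \<in> N \<inter> ?T" using J(5) \<nu> by simp
  moreover have "N \<inter> ?T \<subseteq> ?K"
  proof
    fix \<mu> assume \<mu>: "\<mu> \<in> N \<inter> ?T"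
    then have \<mu>Q: "\<mu> \<in> continuous_valuations X" "\<And>U. openin X U \<Longrightarrow> ennreal (?c U) \<le> \<mu> U"
      using J(6) by (auto simp: valuations_above_def)
    have "ennreal (?c' U) \<le> \<mu> U" if "openin X U" for U
      using \<mu> \<mu>Q(2)[OF that] by (cases "U = topspace X") (simp_all add: c' c_top)
    then show "\<mu> \<in> ?K" using \<mu> \<mu>Q(1) by (simp add: valuations_above_def)
  qed
  moreover have "?K \<subseteq> S'"
  proof -
    have "?Q \<subseteq> valuations_above X ?c"
    proof
      fix \<mu> assume \<mu>: "\<mu> \<in> ?Q"
      have "ennreal (?c U) \<le> \<mu> U" if "openin X U" for U
      proof -
        have "?c U \<le> ?c' U" using sum_le by (simp add: c')
        then have "ennreal (?c U) \<le> ennreal (?c' U)" by (rule ennreal_leI)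
        also have "\<dots> \<le> \<mu> U" using \<mu> that by (simp add: valuations_above_def)
        finally show ?thesis .
      qed
      then show "\<mu> \<in> valuations_above X ?c" using \<mu> by (simp add: valuations_above_def)
    qed
    then show ?thesis using J(7) KT S(2) by blast
  qed
  ultimately show "\<exists>U V. openin (subtopology (valuation_space X) ?T) U \<and>
      compactin (subtopology (valuation_space X) ?T) V \<and> \<nu> \<in> U \<and> U \<subseteq> V \<and> V \<subseteq> S'" by (intro exI conjI)
qed

theorem theorem12p2:
  fixes X :: "'a topology"
  assumes "core_compact_space X"
  shows "strongly_locally_compact_space (valuation_space X) \<and> sober_space (valuation_space X) \<and>
         strongly_locally_compact_space (subprobability_valuation_space X) \<and>
         sober_space (subprobability_valuation_space X) \<and>
         (compact_space X \<longrightarrow>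
           strongly_locally_compact_space (probability_valuation_space X) \<and>
           sober_space (probability_valuation_space X))"
proof (intro conjI impI)
  show "sober_space (valuation_space X)"
    using sober_valuation_subspace[of UNIV X] by (simp add: subtopology_UNIV)
  show "sober_space (subprobability_valuation_space X)"
    unfolding subprobability_valuation_space_def
  proof (rule sober_valuation_subspace)
    fix C :: "('a set \<Rightarrow> ennreal) set" assume "C \<subseteq> {\<nu>. \<nu> (topspace X) \<le> 1}"
    then show "valuation_sup X C \<in> {\<nu>. \<nu> (topspace X) \<le> 1}" by (auto simp: valuation_sup_def intro!: SUP_least)
  qed
  show "sober_space (probability_valuation_space X)"
    unfolding probability_valuation_space_def
  proof (rule sober_valuation_subspace)
    fix C :: "('a set \<Rightarrow> ennreal) set" assume C: "C \<noteq> {}" "C \<subseteq> {\<nu>. \<nu> (topspace X) = 1}"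
    then have "(SUP \<nu>\<in>C. \<nu> (topspace X)) = (SUP \<nu>\<in>C. 1)" by (intro SUP_cong) auto
    then show "valuation_sup X C \<in> {\<nu>. \<nu> (topspace X) = 1}" using C(1) by (simp add: valuation_sup_def)
  qed
qed (use assms in \<open>simp_all add: strongly_locally_compact_valuation_space
    strongly_locally_compact_subprobability_valuation_space strongly_locally_compact_probability_valuation_space\<close>)

end
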